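(* Let $A$ be a finite associative conformal algebra which is free as a $\mathbb{C}[\partial]$-module. Suppose there is another associative conformal algebra structure on the $\mathbb{C}[\partial]$-module $A^{\ast c}$ obtained from a $\mathbb{C}[\partial]$-module homomorphism $\Delta:A\to A\otimes A$. Then $(A,A^{\ast c},R_A^\ast,L_A^\ast,R_{A^{\ast c}}^\ast,L_{A^{\ast c}}^\ast)$ is a matched pair of associative conformal algebras if and only if $\Delta$ satisfies $$\Delta(a_\lambda b)=(I\otimes L_A(a)_\lambda)\Delta(b)+(R_A(b)_{-\lambda-\partial^{\otimes^2}}\otimes I)\Delta(a),$$ $$(L_A(b)_{-\lambda-\partial^{\otimes^2}}\otimes I-I\otimes R_A(b)_{-\lambda-\partial^{\otimes^2}})\Delta(a)+\tau(L_A(a)_\lambda\otimes I-I\otimes R_A(a)_\lambda)\Delta(b)=0,$$ for all $a,b\in A$.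
   Context: Everything is over $\mathbb{C}$. An associative conformal algebra is a $\mathbb{C}[\partial]$-module $A$ with a $\mathbb{C}$-bilinear map $A\times A\to A[\lambda]$, $(a,b)\mapsto a_\lambda b$, such that $(\partial a)_\lambda b=-\lambda a_\lambda b$, $a_\lambda(\partial b)=(\partial+\lambda)(a_\lambda b)$ and $(a_\lambda b)_{\lambda+\mu}c=a_\lambda(b_\mu c)$. It is finite if finitely generated as a $\mathbb{C}[\partial]$-module. Conventions: $x_{-\lambda-\partial}y$ means: write $x_\nu y=\sum_k\nu^k c_k$ and take $\sum_k(-\lambda-\partial)^kc_k$, with $\partial$ acting on the $c_k$ (similarly for $\phi_{-\lambda-\partial}v$). Write $\partial^{\otimes^2}=\partial\otimes1+1\otimes\partial$; $\mathbb{C}[\partial]$ acts on $A\otimes A$ through $\partial^{\otimes^2}$. For operators such as $I\otimes R_A(b)_\nu:A\otimes A\to(A\otimes A)[\nu]$, the subscript $\nu=-\lambda-\partial^{\otimes^2}$ means that in the output each $\nu^k$ is replaced by $(-\lambda-\partial^{\otimes^2})^k$ acting on its coefficient in $A\otimes A$. $\tau(x\otimes y)=y\otimes x$. $Chom(U,V)$: $\mathbb{C}$-linear maps $a_\lambda:U\to V[\lambda]$ with $a_\lambda(\partial u)=(\partial+\lambda)a_\lambda u$, a $\mathbb{C}[\partial]$-module via $(\partial a)_\lambda=-\lambda a_\lambda$; $Cend(V)=Chom(V,V)$; the conformal dual is $U^{\ast c}=Chom(U,\mathbb{C})$, $\mathbb{C}$ with $\partial=0$. The structure on $A^{\ast c}$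 obtained from $\Delta$ is $(f_\lambda g)_\mu(a)=\sum f_\lambda(a_{(1)})g_{\mu-\lambda}(a_{(2)})$, where $\Delta(a)=\sum a_{(1)}\otimes a_{(2)}$. Bimodule $(M,l_A,r_A)$ of $A$: a $\mathbb{C}[\partial]$-module $M$ with $\mathbb{C}[\partial]$-module homomorphisms $l_A,r_A:A\to Cend(M)$ such that $l_A(a_\lambda b)_{\lambda+\mu}v=l_A(a)_\lambda(l_A(b)_\mu v)$, $r_A(b)_{-\lambda-\mu-\partial}(r_A(a)_{-\lambda-\partial}v)=r_A(a_\mu b)_{-\lambda-\partial}v$, $l_A(a)_\lambda(r_A(b)_{-\mu-\partial}v)=r_A(b)_{-\lambda-\mu-\partial}(l_A(a)_\lambda v)$. $L_A(a)_\lambda b=a_\lambda b$, $R_A(a)_\lambda b=b_{-\lambda-\partial}a$. Their duals $L_A^\ast,R_A^\ast:A\to Cend(A^{\ast c})$ are $(L_A^\ast(a)_\lambda f)_\mu b=f_{\mu-\lambda}(L_A(a)_\lambda b)$, $(R_A^\ast(a)_\lambda f)_\mu b=f_{\mu-\lambda}(R_A(a)_\lambda b)$. Likewise $L_{A^{\ast c}}^\ast,R_{A^{\ast c}}^\ast:A^{\ast c}\to Cend(A)$ are defined from the algebra $A^{\ast c}$ after identifying $A\cong (A^{\ast c})^{\ast c}$ by $a_\mu(h)=h_{-\mu}(a)$; explicitly $h_{-\mu}(L_{A^{\ast c}}^\ast(f)_\lambda a)=(f_\lambda h)_{\lambda-\mu}(a)$ and $h_{-\mu}(R_{A^{\ast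 c}}^\ast(f)_\lambda a)=(R_{A^{\ast c}}(f)_\lambda h)_{\lambda-\mu}(a)$ with $R_{A^{\ast c}}(f)_\lambda h=h_{-\lambda-\partial}f$. Matched pair $(A,B,l_A,r_A,l_B,r_B)$: $A,B$ are associative conformal algebras, $(B,l_A,r_A)$ is a bimodule of $A$, $(A,l_B,r_B)$ is a bimodule of $B$, and for all $a,b\in A$, $x,y\in B$: (1) $l_A(a)_\lambda(x_\mu y)=(l_A(a)_\lambda x)_{\lambda+\mu}y+l_A(r_B(x)_{-\lambda-\partial}a)_{\lambda+\mu}y$; (2) $r_B(x)_{-\lambda-\mu-\partial}(a_\lambda b)=a_\lambda(r_B(x)_{-\mu-\partial}b)+r_B(l_A(b)_\mu x)_{-\lambda-\partial}a$; (3) $l_B(x)_\lambda(a_\mu b)=(l_B(x)_\lambda a)_{\lambda+\mu}b+l_B(r_A(a)_{-\lambda-\partial}x)_{\lambda+\mu}b$; (4) $r_A(l_B(y)_\mu a)_{-\lambda-\partial}x+x_\lambda(r_A(a)_{-\mu-\partial}y)=r_A(a)_{-\lambda-\mu-\partial}(x_\lambda y)$; (5) $r_A(r_B(y)_{-\mu-\partial}a)_{-\lambda-\partial}x+x_\lambda(l_A(a)_\mu y)=l_A(l_B(x)_\lambda a)_{\lambda+\mu}y+(r_A(a)_{-\lambda-\partial}x)_{\lambda+\mu}y$; (6) $a_\lambda(l_B(x)_\mu b)+r_B(r_A(b)_{-\mu-\partial}x)_{-\lambda-\partial}a=(r_B(x)_{-\lambda-\partial}a)_{\lambda+\mu}b+l_B(l_A(a)_\lambda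 x)_{\lambda+\mu}b$. *)

theory Defs
  imports
    Complex_Main
    "HOL-Computational_Algebra.Polynomial"
    "HOL-Library.Poly_Mapping"
    "HOL-Library.Function_Algebras"
begin

class complex_vector = ab_group_add +
  fixes scaleC :: "complex \<Rightarrow> 'a \<Rightarrow> 'a" (infixr "*\<^sub>C" 75)
  assumes scaleC_add_right: "c *\<^sub>C (x + y) = c *\<^sub>C x + c *\<^sub>C y"
    and scaleC_add_left: "(c + d) *\<^sub>C x = c *\<^sub>C x + d *\<^sub>C x"
    and scaleC_scaleC: "c *\<^sub>C d *\<^sub>C x = (c * d) *\<^sub>C x"
    and scaleC_one: "1 *\<^sub>C x = x"

lemma vector_space_scaleC:
  "vector_space (scaleC :: complex \<Rightarrow> 'a::complex_vector \<Rightarrow> 'a)"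
  by unfold_locales (simp_all add: scaleC_add_right scaleC_add_left scaleC_scaleC scaleC_one)

interpretation cv: vector_space "scaleC :: complex \<Rightarrow> 'a::complex_vector \<Rightarrow> 'a"
  by (rule vector_space_scaleC)

abbreviation clinear :: "('a::complex_vector \<Rightarrow> 'b::complex_vector) \<Rightarrow> bool"
  where "clinear \<equiv> Vector_Spaces.linear scaleC scaleC"

lemma clinearI:
  assumes "\<And>x y. f (x + y) = f x + f y" and "\<And>c x. f (c *\<^sub>C x) = c *\<^sub>C f x"
  shows "clinear f"
  using assms
  by (simp add: Vector_Spaces.linear_iff vector_space_scaleC)

lemma clinearD:
  assumes "clinear f"
  shows "f (x + y) = f x + f y" "f (c *\<^sub>C x) = c *\<^sub>C f x" "f 0 = 0" "f (- x) = - f x"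
    "f (x - y) = f x - f y" "f (sum g S) = (\<Sum>i\<in>S. f (g i))"
proof -
  interpret module_hom scaleC scaleC f
    using assms by (simp add: Vector_Spaces.linear_def)
  show "f (x + y) = f x + f y" "f (c *\<^sub>C x) = c *\<^sub>C f x" "f 0 = 0" "f (- x) = - f x"
    "f (x - y) = f x - f y" "f (sum g S) = (\<Sum>i\<in>S. f (g i))"
    by (rule add scale zero neg diff sum)+
qed

text \<open>A \<open>\<complex>[\<partial>]\<close>-module is given as a complex vector space with a linear endomorphism \<open>\<partial>\<close>; the
  action of a polynomial is \<open>pact\<close> below.\<close>

class conf_module = complex_vector +
  fixes dop :: "'a \<Rightarrow> 'a" ("\<partial>")
  assumes dop_add: "\<partial> (x + y) = \<partial> x + \<partial> y"
    and dop_scaleC: "\<partial> (c *\<^sub>C x) = c *\<^sub>C \<partial> x"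

lemma clinear_dop: "clinear (\<partial> :: 'a::conf_module \<Rightarrow> 'a)"
  by (rule clinearI) (simp_all add: dop_add dop_scaleC)

lemmas dop_linear = clinearD[OF clinear_dop]

definition pact :: "complex poly \<Rightarrow> 'a::conf_module \<Rightarrow> 'a"
  where "pact p x = (\<Sum>k\<le>degree p. coeff p k *\<^sub>C (\<partial> ^^ k) x)"

lemma clinear_dop_power: "clinear ((\<partial> :: 'a::conf_module \<Rightarrow> 'a) ^^ k)"
  by (rule clinearI; induction k) (simp_all add: dop_add dop_scaleC)

lemmas dop_power_linear = clinearD[OF clinear_dop_power]

lemma pact_bound:
  assumes "degree p \<le> N"
  shows "pact p x = (\<Sum>k\<le>N. coeff p k *\<^sub>C (\<partial> ^^ k) x)"
  unfolding pact_def
  by (rule sum.mono_neutral_left) (use assms in \<open>auto simp: coeff_eq_0\<close>)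

lemma pact_add_left: "pact (p + q) x = pact p x + pact q x"
proof -
  let ?N = "max (degree p) (degree q)"
  have "degree (p + q) \<le> ?N" by (rule degree_add_le_max)
  then show ?thesis
    by (simp add: pact_bound[of _ ?N] scaleC_add_left sum.distrib)
qed

lemma pact_add_right: "pact p (x + y) = pact p x + pact p y"
  by (simp add: pact_def dop_power_linear scaleC_add_right sum.distrib)

lemma pact_smult: "pact (smult c p) x = c *\<^sub>C pact p x"
  by (subst pact_bound[of _ "degree p"])
     (simp_all add: pact_def cv.scale_sum_right)

lemma pact_0: "pact 0 x = 0"
  by (simp add: pact_def)

lemma pact_pCons: "pact (pCons c p) x = c *\<^sub>C x + \<partial> (pact p x)"
proof -
  have "pact (pCons c p) x = (\<Sum>k\<le>Suc (degree p). coeff (pCons c p) k *\<^sub>C (\<partial> ^^ k) x)"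
    by (rule pact_bound) (simp add: degree_pCons_le)
  also have "\<dots> = c *\<^sub>C x + (\<Sum>k\<le>degree p. coeff p k *\<^sub>C \<partial> ((\<partial> ^^ k) x))"
    by (subst sum.atMost_Suc_shift) simp
  finally show ?thesis by (simp add: pact_def dop_linear)
qed

lemma pact_mult: "pact (p * q) x = pact p (pact q x)"
  by (induction p)
     (simp_all add: pact_0 pact_pCons mult_pCons_left pact_add_left pact_smult)

lemma module_pact: "module (pact :: complex poly \<Rightarrow> 'a::conf_module \<Rightarrow> 'a)"
proof
  fix p q :: "complex poly" and x y :: 'a
  show "pact p (x + y) = pact p x + pact p y" by (rule pact_add_right)
  show "pact (p + q) x = pact p x + pact q x" by (rule pact_add_left)
  show "pact p (pact q x) = pact (p * q) x" by (rule pact_mult[symmetric])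
  show "pact 1 x = x" by (simp add: pact_def scaleC_one)
qed

instantiation complex :: conf_module
begin
definition "c *\<^sub>C (z::complex) = c * z"
definition "\<partial> (z::complex) = 0"
instance by standard (simp_all add: scaleC_complex_def dop_complex_def algebra_simps)
end

text \<open>\<open>V[\<lambda>]\<close> is \<open>'v poly\<close> and \<open>V[\<lambda>,\<mu>]\<close> is \<open>'v poly poly\<close>, the outer
  variable being \<open>\<lambda>\<close> and the inner one \<open>\<mu>\<close>. Scalars and \<open>\<partial>\<close> act on coefficients.\<close>

instantiation poly :: (complex_vector) complex_vector
begin
definition "c *\<^sub>C (p::'a poly) = map_poly (scaleC c) p"
lemma coeff_scaleC: "coeff (c *\<^sub>C p) n = c *\<^sub>C coeff p n" for p :: "'a poly"
  by (simp add: scaleC_poly_def coeff_map_poly)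
instance by standard
    (simp_all add: poly_eq_iff coeff_scaleC scaleC_add_right scaleC_add_left scaleC_scaleC scaleC_one)
end

instantiation poly :: (conf_module) conf_module
begin
definition "\<partial> (p::'a poly) = map_poly \<partial> p"
lemma coeff_dop: "coeff (\<partial> p) n = \<partial> (coeff p n)" for p :: "'a poly"
  by (simp add: dop_poly_def coeff_map_poly dop_linear)
instance by standard
    (simp_all add: poly_eq_iff coeff_dop coeff_scaleC dop_linear)
end

definition lam :: "'v::zero poly \<Rightarrow> 'v poly"
  where "lam = pCons 0"

definition mu :: "'v::zero poly poly \<Rightarrow> 'v poly poly"
  where "mu = map_poly (pCons 0)"

text \<open>\<open>psubst e T p\<close> replaces \<open>\<nu>\<close> in \<open>p = \<Sum>k. \<nu>\<^sup>k c\<^sub>k\<close> by the operator \<open>T\<close>, acting on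
  the coefficients \<open>c\<^sub>k\<close> (embedded by \<open>e\<close>). The operators \<open>T\<close> used below are
  pointwise combinations such as \<open>- lam - \<partial>\<close>.\<close>

definition psubst :: "('v::zero \<Rightarrow> 'w) \<Rightarrow> ('w \<Rightarrow> 'w) \<Rightarrow> 'v poly \<Rightarrow> 'w::comm_monoid_add"
  where "psubst e T p = (\<Sum>k\<le>degree p. (T ^^ k) (e (coeff p k)))"

abbreviation cst :: "'v::zero \<Rightarrow> 'v poly"
  where "cst v \<equiv> [:v:]"

abbreviation cst2 :: "'v::zero \<Rightarrow> 'v poly poly" ("\<lbrakk>_\<rbrakk>")
  where "\<lbrakk>v\<rbrakk> \<equiv> [:[:v:]:]"

text \<open>For a bilinear map \<open>f\<close>, written \<open>a\<^sub>\<nu> b\<close>, \<open>act f T P Q\<close> is \<open>P\<^sub>T Q\<close>: the extension of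
  \<open>a\<^sub>\<nu> b\<close> to coefficients in \<open>\<complex>[\<lambda>,\<mu>]\<close> with \<open>\<nu>\<close> replaced by \<open>T\<close> in the output.\<close>

definition act :: "('a \<Rightarrow> 'b \<Rightarrow> 'c poly) \<Rightarrow> ('c poly poly \<Rightarrow> 'c poly poly) \<Rightarrow>
    'a::conf_module poly poly \<Rightarrow> 'b::conf_module poly poly \<Rightarrow> 'c::conf_module poly poly"
  where "act f T P Q =
    (\<Sum>i\<le>degree P. \<Sum>j\<le>degree (coeff P i). \<Sum>k\<le>degree Q. \<Sum>l\<le>degree (coeff Q k).
      (lam ^^ (i + k)) ((mu ^^ (j + l))
        (psubst (\<lambda>v. \<lbrakk>v\<rbrakk>) T (f (coeff (coeff P i) j) (coeff (coeff Q k) l)))))"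

definition assoc_conf_algebra :: "('a \<Rightarrow> 'a \<Rightarrow> 'a::conf_module poly) \<Rightarrow> bool"
  where "assoc_conf_algebra m \<longleftrightarrow>
    (\<forall>a. clinear (m a)) \<and> (\<forall>b. clinear (\<lambda>a. m a b)) \<and>
    (\<forall>a b. m (\<partial> a) b = - lam (m a b)) \<and>
    (\<forall>a b. m a (\<partial> b) = (\<partial> + lam) (m a b)) \<and>
    (\<forall>a b c. act m (lam + mu) (act m lam \<lbrakk>a\<rbrakk> \<lbrakk>b\<rbrakk>) \<lbrakk>c\<rbrakk> = act m lam \<lbrakk>a\<rbrakk> (act m mu \<lbrakk>b\<rbrakk> \<lbrakk>c\<rbrakk>))"

typedef (overloaded) ('u, 'v) chom =
  "{F :: 'u::conf_module \<Rightarrow> 'v::conf_module poly. clinear F \<and> (\<forall>u. F (\<partial> u) = (\<partial> + lam) (F u))}"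
  morphisms app Abs_chom
proof
  show "(\<lambda>_. 0) \<in> {F :: 'u \<Rightarrow> 'v poly. clinear F \<and> (\<forall>u. F (\<partial> u) = (\<partial> + lam) (F u))}"
    by (auto intro!: clinearI simp: dop_linear lam_def)
qed

setup_lifting type_definition_chom

lemma lam_add: "lam (p + q) = lam p + lam q" for p q :: "'v::comm_monoid_add poly"
  by (simp add: lam_def)

lemma lam_uminus: "lam (- p) = - lam p" for p :: "'v::ab_group_add poly"
  by (simp add: lam_def)

lemma lam_diff: "lam (p - q) = lam p - lam q" for p q :: "'v::ab_group_add poly"
  by (simp add: lam_def)

lemma lam_scaleC: "lam (c *\<^sub>C p) = c *\<^sub>C lam p" for p :: "'v::complex_vector poly"
  by (simp add: lam_def poly_eq_iff coeff_scaleC coeff_pCons split: nat.split)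

lemma lam_dop: "\<partial> (lam p) = lam (\<partial> p)" for p :: "'v::conf_module poly"
  by (simp add: lam_def poly_eq_iff coeff_dop coeff_pCons dop_linear split: nat.split)

text \<open>The module structure on \<open>Chom(U,V)\<close>: \<open>(\<partial> a)\<^sub>\<lambda> = -\<lambda> a\<^sub>\<lambda>\<close>.\<close>

instantiation chom :: (conf_module, conf_module) conf_module
begin

lift_definition zero_chom :: "('a, 'b) chom" is "\<lambda>_. 0"
  by (auto intro!: clinearI simp: dop_linear lam_def)

lift_definition plus_chom :: "('a, 'b) chom \<Rightarrow> ('a, 'b) chom \<Rightarrow> ('a, 'b) chom"
  is "\<lambda>F G u. F u + G u"
  subgoal for F G
    using clinearD[of F] clinearD[of G]
    by (auto intro!: clinearI simp: dop_linear lam_add scaleC_add_right)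
  done

lift_definition uminus_chom :: "('a, 'b) chom \<Rightarrow> ('a, 'b) chom"
  is "\<lambda>F u. - F u"
  subgoal for F
    using clinearD[of F] by (auto intro!: clinearI simp: dop_linear lam_uminus)
  done

lift_definition minus_chom :: "('a, 'b) chom \<Rightarrow> ('a, 'b) chom \<Rightarrow> ('a, 'b) chom"
  is "\<lambda>F G u. F u - G u"
  subgoal for F G
    using clinearD[of F] clinearD[of G]
    by (auto intro!: clinearI simp: dop_linear lam_diff cv.scale_right_diff_distrib)
  done

lift_definition scaleC_chom :: "complex \<Rightarrow> ('a, 'b) chom \<Rightarrow> ('a, 'b) chom"
  is "\<lambda>c F u. c *\<^sub>C F u"
  subgoal for c F
    using clinearD[of F]
    by (auto intro!: clinearI
        simp: dop_linear lam_scaleC scaleC_add_right scaleC_scaleC mult.commute)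
  done

lift_definition dop_chom :: "('a, 'b) chom \<Rightarrow> ('a, 'b) chom"
  is "\<lambda>F u. - lam (F u)"
  subgoal for F
    using clinearD[of F]
    by (auto intro!: clinearI
        simp: dop_linear lam_add lam_scaleC lam_dop lam_uminus)
  done

instance
  by standard
    (transfer; simp add: fun_eq_iff algebra_simps scaleC_add_right scaleC_add_left scaleC_scaleC
      scaleC_one lam_add lam_scaleC)+

end

type_synonym 'v cend = "('v, 'v) chom"

text \<open>The conformal dual; \<open>complex\<close> carries \<open>\<partial> = 0\<close>.\<close>

type_synonym 'v cdual = "('v, complex) chom"

instantiation poly_mapping :: (type, complex_vector) complex_vector
begin
lift_definition scaleC_poly_mapping ::
  "complex \<Rightarrow> ('a \<Rightarrow>\<^sub>0 'b) \<Rightarrow> ('a \<Rightarrow>\<^sub>0 'b)" is "\<lambda>c f x. c *\<^sub>C f x"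
  by (rule finite_subset[rotated]) auto
instance by standard (transfer; simp add: fun_eq_iff plus_fun_def
    scaleC_add_right scaleC_add_left scaleC_scaleC scaleC_one)+
end

definition tensor_rels :: "(('a::complex_vector \<times> 'b::complex_vector) \<Rightarrow>\<^sub>0 complex) set"
  where "tensor_rels =
    (\<Union>x x' y. {Poly_Mapping.single (x + x', y) 1
        - Poly_Mapping.single (x, y) 1 - Poly_Mapping.single (x', y) 1}) \<union>
    (\<Union>x y y'. {Poly_Mapping.single (x, y + y') 1
        - Poly_Mapping.single (x, y) 1 - Poly_Mapping.single (x, y') 1}) \<union>
    (\<Union>c x y. {Poly_Mapping.single (c *\<^sub>C x, y) 1 - c *\<^sub>C Poly_Mapping.single (x, y) 1}) \<union>
    (\<Union>c x y. {Poly_Mapping.single (x, c *\<^sub>C y) 1 - c *\<^sub>C Poly_Mapping.single (x, y) 1})"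

definition tensor_eq ::
  "(('a::complex_vector \<times> 'b::complex_vector) \<Rightarrow>\<^sub>0 complex) \<Rightarrow> (('a \<times> 'b) \<Rightarrow>\<^sub>0 complex) \<Rightarrow> bool"
  where "tensor_eq r s \<longleftrightarrow> r - s \<in> module.span scaleC tensor_rels"

lemma equivp_tensor_eq: "equivp tensor_eq"
proof (rule equivpI)
  show "reflp tensor_eq"
    by (rule reflpI) (simp add: tensor_eq_def cv.span_zero)
  show "symp tensor_eq"
    by (rule sympI) (use cv.span_neg in \<open>fastforce simp: tensor_eq_def\<close>)
  show "transp tensor_eq"
    by (rule transpI) (use cv.span_add in \<open>fastforce simp: tensor_eq_def\<close>)
qed

quotient_type (overloaded) ('a, 'b) tensor (infixr "\<otimes>" 70) =
  "('a::complex_vector \<times> 'b::complex_vector) \<Rightarrow>\<^sub>0 complex" / tensor_eq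
  by (rule equivp_tensor_eq)

instantiation tensor :: (complex_vector, complex_vector) complex_vector
begin

lift_definition zero_tensor :: "'a \<otimes> 'b" is 0 .

lift_definition plus_tensor :: "'a \<otimes> 'b \<Rightarrow> 'a \<otimes> 'b \<Rightarrow> 'a \<otimes> 'b" is "(+)"
  unfolding tensor_eq_def by (subst add_diff_add) (rule cv.span_add)

lift_definition uminus_tensor :: "'a \<otimes> 'b \<Rightarrow> 'a \<otimes> 'b" is "uminus"
  unfolding tensor_eq_def by (subst minus_diff_minus) (rule cv.span_neg)

lift_definition minus_tensor :: "'a \<otimes> 'b \<Rightarrow> 'a \<otimes> 'b \<Rightarrow> 'a \<otimes> 'b" is "(-)"
proof -
  fix r r' s s' :: "('a \<times> 'b) \<Rightarrow>\<^sub>0 complex"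
  assume "tensor_eq r r'" "tensor_eq s s'"
  moreover have "(r - s) - (r' - s') = (r - r') - (s - s')" by simp
  ultimately show "tensor_eq (r - s) (r' - s')"
    unfolding tensor_eq_def by (simp only: cv.span_diff)
qed

lift_definition scaleC_tensor :: "complex \<Rightarrow> 'a \<otimes> 'b \<Rightarrow> 'a \<otimes> 'b" is "scaleC"
  unfolding tensor_eq_def
  by (subst cv.scale_right_diff_distrib[symmetric]) (rule cv.span_scale)

instance
  by standard
    (transfer; simp add: tensor_eq_def cv.span_zero algebra_simps
      scaleC_add_right scaleC_add_left scaleC_scaleC scaleC_one)+

end

lift_definition tens :: "'a::complex_vector \<Rightarrow> 'b::complex_vector \<Rightarrow> 'a \<otimes> 'b" (infixr "\<otimes>\<^sub>t" 70)
  is "\<lambda>x y. Poly_Mapping.single (x, y) 1" .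

text \<open>The linear map on the tensor product induced by a bilinear map \<open>f\<close>. For bilinear \<open>f\<close> the
  choice of the representative is immaterial, see \<open>tlift_tens\<close> and \<open>clinear_tlift\<close>.\<close>

definition free_lift :: "('i \<Rightarrow> 'c::complex_vector) \<Rightarrow> ('i \<Rightarrow>\<^sub>0 complex) \<Rightarrow> 'c"
  where "free_lift f r = (\<Sum>i\<in>Poly_Mapping.keys r. Poly_Mapping.lookup r i *\<^sub>C f i)"

definition tlift :: "('a::complex_vector \<Rightarrow> 'b::complex_vector \<Rightarrow> 'c::complex_vector) \<Rightarrow> 'a \<otimes> 'b \<Rightarrow> 'c"
  where "tlift f t = free_lift (\<lambda>(x, y). f x y) (rep_tensor t)"

lemma lookup_scaleC:
  "Poly_Mapping.lookup (c *\<^sub>C r) i = c *\<^sub>C Poly_Mapping.lookup r i"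
  by transfer simp

lemma free_lift_superset:
  assumes "finite S" "Poly_Mapping.keys r \<subseteq> S"
  shows "free_lift f r = (\<Sum>i\<in>S. Poly_Mapping.lookup r i *\<^sub>C f i)"
  unfolding free_lift_def
  by (rule sum.mono_neutral_left) (use assms in \<open>auto simp: in_keys_iff\<close>)

lemma clinear_free_lift: "clinear (free_lift f)"
proof (rule clinearI)
  fix r s :: "'a \<Rightarrow>\<^sub>0 complex" and c :: complex
  let ?S = "Poly_Mapping.keys r \<union> Poly_Mapping.keys s"
  have "Poly_Mapping.keys (r + s) \<subseteq> ?S" by (rule Poly_Mapping.keys_add)
  then show "free_lift f (r + s) = free_lift f r + free_lift f s"
    by (simp add: free_lift_superset[of ?S] lookup_add scaleC_add_left sum.distrib)
  have "Poly_Mapping.keys (c *\<^sub>C r) \<subseteq> Poly_Mapping.keys r"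
    by (auto simp: in_keys_iff lookup_scaleC)
  then show "free_lift f (c *\<^sub>C r) = c *\<^sub>C free_lift f r"
    by (simp add: free_lift_superset[of "Poly_Mapping.keys r"] lookup_scaleC scaleC_complex_def
        cv.scale_sum_right scaleC_scaleC)
qed

lemma free_lift_single: "free_lift f (Poly_Mapping.single i c) = c *\<^sub>C f i"
  by (simp add: free_lift_def)

lemma free_lift_rels:
  assumes "\<And>x. clinear (f x)" "\<And>y. clinear (\<lambda>x. f x y)"
    and "r \<in> module.span scaleC tensor_rels"
  shows "free_lift (\<lambda>(x, y). f x y) r = 0"
  using assms(3)
proof (induction rule: cv.span_induct)
  case base
  show ?case
    by (rule cv.subspaceI) (auto simp: clinearD[OF clinear_free_lift])
next
  case (step r)
  then show ?case
    using clinearD[OF assms(1)] clinearD[OF assms(2)]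
    by (auto simp: tensor_rels_def clinearD[OF clinear_free_lift] free_lift_single scaleC_one)
qed

lemma tlift_abs:
  assumes "\<And>x. clinear (f x)" "\<And>y. clinear (\<lambda>x. f x y)"
  shows "tlift f (abs_tensor r) = free_lift (\<lambda>(x, y). f x y) r"
proof -
  have "tensor_eq (rep_tensor (abs_tensor r)) r"
    by (rule Quotient3_rep_abs[OF Quotient3_tensor]) (simp add: tensor_eq_def cv.span_zero)
  then have "free_lift (\<lambda>(x, y). f x y) (rep_tensor (abs_tensor r) - r) = 0"
    unfolding tensor_eq_def by (rule free_lift_rels[OF assms])
  then show ?thesis
    by (simp add: tlift_def clinearD[OF clinear_free_lift])
qed

lemma tlift_tens:
  assumes "\<And>x. clinear (f x)" "\<And>y. clinear (\<lambda>x. f x y)"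
  shows "tlift f (x \<otimes>\<^sub>t y) = f x y"
  by (simp add: tens.abs_eq tlift_abs[OF assms] free_lift_single scaleC_one)

lemma clinear_tlift:
  assumes "\<And>x. clinear (f x)" "\<And>y. clinear (\<lambda>x. f x y)"
  shows "clinear (tlift f)"
proof (rule clinearI)
  fix s t :: "'a \<otimes> 'b" and c :: complex
  show "tlift f (s + t) = tlift f s + tlift f t"
    by (induction s; induction t)
       (simp add: plus_tensor.abs_eq tlift_abs[OF assms] clinearD[OF clinear_free_lift])
  show "tlift f (c *\<^sub>C s) = c *\<^sub>C tlift f s"
    by (induction s)
       (simp add: scaleC_tensor.abs_eq tlift_abs[OF assms] clinearD[OF clinear_free_lift])
qed

lemma tensor_eq_rel: "r - s \<in> tensor_rels \<Longrightarrow> tensor_eq r s"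
  unfolding tensor_eq_def by (rule cv.span_base)

lemma tens_add_left: "(x + x') \<otimes>\<^sub>t y = x \<otimes>\<^sub>t y + x' \<otimes>\<^sub>t y"
  by transfer (rule tensor_eq_rel, subst diff_diff_eq[symmetric], unfold tensor_rels_def,
      rule UnI1, rule UnI1, rule UnI1,
      (rule UN_I[OF UNIV_I])+, rule singletonI)

lemma tens_add_right: "x \<otimes>\<^sub>t (y + y') = x \<otimes>\<^sub>t y + x \<otimes>\<^sub>t y'"
  by transfer (rule tensor_eq_rel, subst diff_diff_eq[symmetric], unfold tensor_rels_def,
      rule UnI1, rule UnI1, rule UnI2,
      (rule UN_I[OF UNIV_I])+, rule singletonI)

lemma tens_scaleC_left: "(c *\<^sub>C x) \<otimes>\<^sub>t y = c *\<^sub>C (x \<otimes>\<^sub>t y)"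
  by transfer (rule tensor_eq_rel, unfold tensor_rels_def, rule UnI1, rule UnI2,
      (rule UN_I[OF UNIV_I])+, rule singletonI)

lemma tens_scaleC_right: "x \<otimes>\<^sub>t (c *\<^sub>C y) = c *\<^sub>C (x \<otimes>\<^sub>t y)"
  by transfer (rule tensor_eq_rel, unfold tensor_rels_def, rule UnI2,
      (rule UN_I[OF UNIV_I])+, rule singletonI)

lemma tens_bilinear: "clinear (\<lambda>y. x \<otimes>\<^sub>t y)" "clinear (\<lambda>x. x \<otimes>\<^sub>t y)"
  by (simp_all add: clinearI tens_add_left tens_add_right tens_scaleC_left tens_scaleC_right)

text \<open>\<open>\<partial>\<close> acts on the tensor product by \<open>\<partial> \<otimes> 1 + 1 \<otimes> \<partial>\<close>.\<close>

instantiation tensor :: (conf_module, conf_module) conf_module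
begin
definition dop_tensor :: "'a \<otimes> 'b \<Rightarrow> 'a \<otimes> 'b"
  where "\<partial> = tlift (\<lambda>x y. \<partial> x \<otimes>\<^sub>t y + x \<otimes>\<^sub>t \<partial> y)"
instance
proof -
  have "clinear (\<lambda>y. \<partial> x \<otimes>\<^sub>t y + x \<otimes>\<^sub>t \<partial> y)" for x :: 'a and y :: 'b
    by (rule clinearI) (simp_all add: dop_linear clinearD[OF tens_bilinear(1)]
        scaleC_add_right)
  moreover have "clinear (\<lambda>x. \<partial> x \<otimes>\<^sub>t y + x \<otimes>\<^sub>t \<partial> y)" for x :: 'a and y :: 'b
    by (rule clinearI) (simp_all add: dop_linear clinearD[OF tens_bilinear(2)]
        scaleC_add_right)
  ultimately have "clinear (\<partial> :: 'a \<otimes> 'b \<Rightarrow> 'a \<otimes> 'b)"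
    unfolding dop_tensor_def by (intro clinear_tlift)
  then show "OFCLASS('a \<otimes> 'b, conf_module_class)"
    by intro_classes (simp_all add: clinearD)
qed
end

definition tswap :: "'a::conf_module \<otimes> 'b::conf_module \<Rightarrow> 'b \<otimes> 'a" ("\<tau>")
  where "\<tau> = tlift (\<lambda>x y. y \<otimes>\<^sub>t x)"

text \<open>\<open>F\<^sub>\<lambda> \<otimes> I\<close> and \<open>I \<otimes> F\<^sub>\<lambda>\<close>.\<close>

definition tensor_left :: "'a cend \<Rightarrow> 'a::conf_module \<otimes> 'b::conf_module \<Rightarrow> ('a \<otimes> 'b) poly"
  where "tensor_left F = tlift (\<lambda>x y. map_poly (\<lambda>v. v \<otimes>\<^sub>t y) (app F x))"

definition tensor_right :: "'b cend \<Rightarrow> 'a::conf_module \<otimes> 'b::conf_module \<Rightarrow> ('a \<otimes> 'b) poly"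
  where "tensor_right F = tlift (\<lambda>x y. map_poly (\<lambda>v. x \<otimes>\<^sub>t v) (app F y))"

abbreviation mact :: "('a \<Rightarrow> 'm cend) \<Rightarrow> ('m poly poly \<Rightarrow> 'm poly poly) \<Rightarrow>
    'a::conf_module poly poly \<Rightarrow> 'm::conf_module poly poly \<Rightarrow> 'm poly poly"
  where "mact l \<equiv> act (\<lambda>a. app (l a))"

definition conf_bimodule ::
  "('a \<Rightarrow> 'a \<Rightarrow> 'a::conf_module poly) \<Rightarrow> ('a \<Rightarrow> 'm::conf_module cend) \<Rightarrow> ('a \<Rightarrow> 'm cend) \<Rightarrow> bool"
  where "conf_bimodule m l r \<longleftrightarrow>
    module_hom pact pact l \<and> module_hom pact pact r \<and>
    (\<forall>a b v. mact l (lam + mu) (act m lam \<lbrakk>a\<rbrakk> \<lbrakk>b\<rbrakk>) \<lbrakk>v\<rbrakk> = mact l lam \<lbrakk>a\<rbrakk> (mact l mu \<lbrakk>b\<rbrakk> \<lbrakk>v\<rbrakk>)) \<and>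
    (\<forall>a b v. mact r (- lam - mu - \<partial>) \<lbrakk>b\<rbrakk> (mact r (- lam - \<partial>) \<lbrakk>a\<rbrakk> \<lbrakk>v\<rbrakk>)
           = mact r (- lam - \<partial>) (act m mu \<lbrakk>a\<rbrakk> \<lbrakk>b\<rbrakk>) \<lbrakk>v\<rbrakk>) \<and>
    (\<forall>a b v. mact l lam \<lbrakk>a\<rbrakk> (mact r (- mu - \<partial>) \<lbrakk>b\<rbrakk> \<lbrakk>v\<rbrakk>)
           = mact r (- lam - mu - \<partial>) \<lbrakk>b\<rbrakk> (mact l lam \<lbrakk>a\<rbrakk> \<lbrakk>v\<rbrakk>))"

definition matched_pair ::
  "('a \<Rightarrow> 'a \<Rightarrow> 'a::conf_module poly) \<Rightarrow> ('b \<Rightarrow> 'b \<Rightarrow> 'b::conf_module poly) \<Rightarrow>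
   ('a \<Rightarrow> 'b cend) \<Rightarrow> ('a \<Rightarrow> 'b cend) \<Rightarrow> ('b \<Rightarrow> 'a cend) \<Rightarrow> ('b \<Rightarrow> 'a cend) \<Rightarrow> bool"
  where "matched_pair mA mB lA rA lB rB \<longleftrightarrow>
    assoc_conf_algebra mA \<and> assoc_conf_algebra mB \<and>
    conf_bimodule mA lA rA \<and> conf_bimodule mB lB rB \<and>
    (\<forall>a x y. mact lA lam \<lbrakk>a\<rbrakk> (act mB mu \<lbrakk>x\<rbrakk> \<lbrakk>y\<rbrakk>)
       = act mB (lam + mu) (mact lA lam \<lbrakk>a\<rbrakk> \<lbrakk>x\<rbrakk>) \<lbrakk>y\<rbrakk>
       + mact lA (lam + mu) (mact rB (- lam - \<partial>) \<lbrakk>x\<rbrakk> \<lbrakk>a\<rbrakk>) \<lbrakk>y\<rbrakk>) \<and>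
    (\<forall>a b x. mact rB (- lam - mu - \<partial>) \<lbrakk>x\<rbrakk> (act mA lam \<lbrakk>a\<rbrakk> \<lbrakk>b\<rbrakk>)
       = act mA lam \<lbrakk>a\<rbrakk> (mact rB (- mu - \<partial>) \<lbrakk>x\<rbrakk> \<lbrakk>b\<rbrakk>)
       + mact rB (- lam - \<partial>) (mact lA mu \<lbrakk>b\<rbrakk> \<lbrakk>x\<rbrakk>) \<lbrakk>a\<rbrakk>) \<and>
    (\<forall>a b x. mact lB lam \<lbrakk>x\<rbrakk> (act mA mu \<lbrakk>a\<rbrakk> \<lbrakk>b\<rbrakk>)
       = act mA (lam + mu) (mact lB lam \<lbrakk>x\<rbrakk> \<lbrakk>a\<rbrakk>) \<lbrakk>b\<rbrakk>
       + mact lB (lam + mu) (mact rA (- lam - \<partial>) \<lbrakk>a\<rbrakk> \<lbrakk>x\<rbrakk>) \<lbrakk>b\<rbrakk>) \<and>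
    (\<forall>a x y. mact rA (- lam - \<partial>) (mact lB mu \<lbrakk>y\<rbrakk> \<lbrakk>a\<rbrakk>) \<lbrakk>x\<rbrakk>
       + act mB lam \<lbrakk>x\<rbrakk> (mact rA (- mu - \<partial>) \<lbrakk>a\<rbrakk> \<lbrakk>y\<rbrakk>)
       = mact rA (- lam - mu - \<partial>) \<lbrakk>a\<rbrakk> (act mB lam \<lbrakk>x\<rbrakk> \<lbrakk>y\<rbrakk>)) \<and>
    (\<forall>a x y. mact rA (- lam - \<partial>) (mact rB (- mu - \<partial>) \<lbrakk>y\<rbrakk> \<lbrakk>a\<rbrakk>) \<lbrakk>x\<rbrakk>
       + act mB lam \<lbrakk>x\<rbrakk> (mact lA mu \<lbrakk>a\<rbrakk> \<lbrakk>y\<rbrakk>)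
       = mact lA (lam + mu) (mact lB lam \<lbrakk>x\<rbrakk> \<lbrakk>a\<rbrakk>) \<lbrakk>y\<rbrakk>
       + act mB (lam + mu) (mact rA (- lam - \<partial>) \<lbrakk>a\<rbrakk> \<lbrakk>x\<rbrakk>) \<lbrakk>y\<rbrakk>) \<and>
    (\<forall>a b x. act mA lam \<lbrakk>a\<rbrakk> (mact lB mu \<lbrakk>x\<rbrakk> \<lbrakk>b\<rbrakk>)
       + mact rB (- lam - \<partial>) (mact rA (- mu - \<partial>) \<lbrakk>b\<rbrakk> \<lbrakk>x\<rbrakk>) \<lbrakk>a\<rbrakk>
       = act mA (lam + mu) (mact rB (- lam - \<partial>) \<lbrakk>x\<rbrakk> \<lbrakk>a\<rbrakk>) \<lbrakk>b\<rbrakk>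
       + mact lB (lam + mu) (mact lA lam \<lbrakk>a\<rbrakk> \<lbrakk>x\<rbrakk>) \<lbrakk>b\<rbrakk>)"

text \<open>\<open>L(a)\<^sub>\<lambda> b = a\<^sub>\<lambda> b\<close> and \<open>R(a)\<^sub>\<lambda> b = b\<^bsub>-\<lambda>-\<partial>\<^esub> a\<close>; both are conformal linear when \<open>m\<close> is an
  associative conformal algebra.\<close>

definition Lmul :: "('a \<Rightarrow> 'a \<Rightarrow> 'a::conf_module poly) \<Rightarrow> 'a \<Rightarrow> 'a cend"
  where "Lmul m a = Abs_chom (\<lambda>b. m a b)"

definition Rmul :: "('a \<Rightarrow> 'a \<Rightarrow> 'a::conf_module poly) \<Rightarrow> 'a \<Rightarrow> 'a cend"
  where "Rmul m a = Abs_chom (\<lambda>b. psubst cst (- lam - \<partial>) (m b a))"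

text \<open>The dual \<open>F\<^sup>*\<close> of \<open>F \<in> Cend(V)\<close>: \<open>(F\<^sup>*\<^sub>\<lambda> f)\<^sub>\<mu> v = f\<^bsub>\<mu>-\<lambda>\<^esub>(F\<^sub>\<lambda> v)\<close>. It is unique, and it exists
  when \<open>V\<close> is finitely generated over \<open>\<complex>[\<partial>]\<close>, which bounds the degree in \<open>\<lambda>\<close>.\<close>

definition cdual_map :: "'v::conf_module cend \<Rightarrow> 'v cdual cend"
  where "cdual_map F = (THE G. \<forall>f v.
    act app mu (act app lam \<lbrakk>G\<rbrakk> \<lbrakk>f\<rbrakk>) \<lbrakk>v\<rbrakk> = act app (mu - lam) \<lbrakk>f\<rbrakk> (act app lam \<lbrakk>F\<rbrakk> \<lbrakk>v\<rbrakk>))"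

text \<open>The dual of \<open>G \<in> Cend(V\<^sup>*\<^sup>c)\<close>, read on \<open>V\<close> through the identification of \<open>v\<close> with
  \<open>v\<^sub>\<mu>(h) = h\<^bsub>-\<mu>\<^esub>(v)\<close>: \<open>h\<^bsub>-\<mu>\<^esub>(F\<^sub>\<lambda> v) = (G\<^sub>\<lambda> h)\<^bsub>\<lambda>-\<mu>\<^esub>(v)\<close>. Existence and uniqueness hold for
  \<open>V\<close> free of finite rank over \<open>\<complex>[\<partial>]\<close>.\<close>

definition cpredual_map :: "'v cdual cend \<Rightarrow> 'v::conf_module cend"
  where "cpredual_map G = (THE F. \<forall>h v.
    act app (- mu) \<lbrakk>h\<rbrakk> (act app lam \<lbrakk>F\<rbrakk> \<lbrakk>v\<rbrakk>) = act app (lam - mu) (act app lam \<lbrakk>G\<rbrakk> \<lbrakk>h\<rbrakk>) \<lbrakk>v\<rbrakk>)"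

text \<open>The product \<open>m\<close> on the dual is given by \<open>(f\<^sub>\<lambda> g)\<^sub>\<mu>(a) = \<Sum> f\<^sub>\<lambda>(a\<^sub>1) g\<^bsub>\<mu>-\<lambda>\<^esub>(a\<^sub>2)\<close>, where
  \<open>\<Delta> a = \<Sum> a\<^sub>1 \<otimes> a\<^sub>2\<close>; the product on the right is that of \<open>\<complex>[\<lambda>,\<mu>]\<close>.\<close>

definition induced_by :: "('a cdual \<Rightarrow> 'a cdual \<Rightarrow> 'a cdual poly) \<Rightarrow>
    ('a \<Rightarrow> 'a \<otimes> 'a::conf_module) \<Rightarrow> bool"
  where "induced_by m \<Delta> \<longleftrightarrow> (\<forall>f g a.
    act app mu (act m lam \<lbrakk>f\<rbrakk> \<lbrakk>g\<rbrakk>) \<lbrakk>a\<rbrakk>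
    = tlift (\<lambda>x y. act app lam \<lbrakk>f\<rbrakk> \<lbrakk>x\<rbrakk> * act app (mu - lam) \<lbrakk>g\<rbrakk> \<lbrakk>y\<rbrakk>) (\<Delta> a))"

end

theory Submission
  imports Defs
begin

text \<open>
  A polynomial over a complex vector space is determined by its values at complex numbers, so every
  identity in \<open>V[\<lambda>,\<mu>]\<close> is tested at \<open>\<lambda> = l\<close>, \<open>\<mu> = m\<close>; elements of \<open>A\<close> and \<open>A \<otimes> A\<close> are tested
  against \<open>f\<^sub>\<alpha>\<close> and \<open>f\<^sub>\<alpha> \<otimes> g\<^sub>\<beta>\<close> with \<open>f, g\<close> in the conformal dual, which separate points because
  \<open>A\<close> is free. Under \<open>f\<^sub>\<alpha>\<close> the operator \<open>\<partial>\<close> becomes the number \<open>\<alpha>\<close>, so a substitution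
  \<open>\<nu> = -\<lambda> - \<partial>\<close> becomes evaluation at \<open>-\<lambda> - \<alpha>\<close>.

  The dual algebra acts on \<open>A\<close> by contraction, \<open>l\<^sub>B(f)\<^sub>\<lambda> a = \<Sum> f\<^sub>\<lambda>(a\<^sub>2) a\<^sub>1\<close> and
  \<open>r\<^sub>B(f)\<^sub>\<lambda> a = \<Sum> f\<^sub>\<lambda>(a\<^sub>1) a\<^sub>2\<close>. After evaluation, the bimodule axioms are instances of associativity,
  each of the conditions (1)-(4) of a matched pair is the first equation for \<open>\<Delta>\<close> with its three
  complex parameters renamed, and (5), (6) are likewise the second equation.
\<close>

section \<open>Evaluation of polynomials over a vector space\<close>

lemma psubst_bound:
  assumes "degree p \<le> N" "clinear e" "clinear T"
  shows "psubst e T p = (\<Sum>k\<le>N. (T ^^ k) (e (coeff p k)))"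
proof -
  have "(T ^^ k) 0 = 0" for k
    by (induction k) (simp_all add: clinearD[OF assms(3)])
  then show ?thesis
    unfolding psubst_def using assms(1)
    by (intro sum.mono_neutral_left) (auto simp: coeff_eq_0 clinearD[OF assms(2)])
qed

lemma clinear_compose: "clinear f \<Longrightarrow> clinear g \<Longrightarrow> clinear (\<lambda>x. f (g x))"
  by (rule clinearI) (simp_all add: clinearD)

lemma clinear_funpow: "clinear T \<Longrightarrow> clinear (T ^^ k)" for T :: "'v::complex_vector \<Rightarrow> 'v"
  by (induction k) (auto simp: comp_def id_def intro: clinear_compose clinearI)

lemma clinear_psubst:
  assumes e: "clinear e" and T: "clinear T"
  shows "clinear (psubst e T)"
proof (rule clinearI)
  fix p q :: "'a poly" and c :: complex
  let ?N = "max (degree p) (degree q)"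
  note Tk = clinearD[OF clinear_funpow[OF T]]
  have "degree (p + q) \<le> ?N" by (rule degree_add_le_max)
  then show "psubst e T (p + q) = psubst e T p + psubst e T q"
    by (simp add: psubst_bound[of _ ?N, OF _ assms] clinearD[OF e] Tk sum.distrib)
  have "degree (c *\<^sub>C p) \<le> degree p"
    by (rule degree_le) (simp add: coeff_scaleC coeff_eq_0)
  then show "psubst e T (c *\<^sub>C p) = c *\<^sub>C psubst e T p"
    by (simp add: psubst_bound[of _ "degree p", OF _ assms] coeff_scaleC clinearD[OF e] Tk
        cv.scale_sum_right)
qed

text \<open>An intertwiner of \<open>T\<close> and \<open>S\<close> also intertwines their powers.
  In the uses below \<open>h\<close> is an evaluation or a functional, and \<open>S\<close> is
  simpler than \<open>T\<close>, often a scalar.\<close>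

lemma psubst_comm:
  assumes "clinear h" "\<And>x. h (T x) = S (h x)"
  shows "h (psubst e T p) = psubst (\<lambda>v. h (e v)) S p"
proof -
  have "h ((T ^^ k) x) = (S ^^ k) (h x)" for k x
    by (induction k) (simp_all add: assms(2))
  then show ?thesis
    by (simp add: psubst_def clinearD[OF assms(1)])
qed

lemma psubst_lam:
  assumes "clinear e" "clinear T"
  shows "psubst e T (lam p) = T (psubst e T p)"
proof -
  have "degree (lam p) \<le> Suc (degree p)"
    by (simp add: lam_def degree_pCons_le)
  then show ?thesis
    by (subst psubst_bound[OF _ assms], assumption, subst sum.atMost_Suc_shift)
      (simp add: lam_def psubst_def clinearD[OF assms(1)] clinearD[OF assms(2)])
qed

lemma psubst_map_poly:
  assumes "clinear h" "clinear e" "clinear T"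
  shows "psubst e T (map_poly h p) = psubst (\<lambda>v. e (h v)) T p"
proof -
  have "degree (map_poly h p) \<le> degree p"
    by (rule degree_le) (simp add: coeff_map_poly clinearD[OF assms(1)] coeff_eq_0)
  then show ?thesis
    by (simp add: psubst_bound[OF _ assms(2,3)] coeff_map_poly clinearD[OF assms(1)])
      (simp add: psubst_def)
qed

text \<open>Evaluation is encoded as the substitution of a scalar operator, so that the facts on
  \<open>psubst\<close> apply to it.\<close>

definition pev :: "'v::complex_vector poly \<Rightarrow> complex \<Rightarrow> 'v"
  where "pev p z = psubst id (scaleC z) p"

lemma clinear_scaleC: "clinear (scaleC z)"
  by (rule clinearI) (simp_all add: scaleC_add_right scaleC_scaleC mult.commute)

lemma clinear_id: "clinear id" "clinear (\<lambda>x. x)"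
  by (auto intro!: clinearI)

lemma clinear_pev: "clinear (\<lambda>p. pev p z)"
  unfolding pev_def by (intro clinear_psubst clinear_id clinear_scaleC)

lemmas pev_linear = clinearD[OF clinear_pev]

lemma pev_0 [simp]: "pev 0 z = 0"
  by (rule pev_linear)

lemma pev_lam: "pev (lam p) z = z *\<^sub>C pev p z"
  unfolding pev_def by (intro psubst_lam clinear_id clinear_scaleC)

lemma pev_map_poly: "clinear h \<Longrightarrow> pev (map_poly h p) z = h (pev p z)"
  unfolding pev_def
  by (subst psubst_map_poly)
    (simp_all add: clinear_id clinear_scaleC clinearD psubst_comm[where h = h and S = "scaleC z"]
      comp_def id_def)

lemma pev_dop: "pev (\<partial> p) z = \<partial> (pev p z)"
  unfolding dop_poly_def by (rule pev_map_poly[OF clinear_dop])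

lemma pev_cst [simp]: "pev [:v:] z = v"
  by (simp add: pev_def psubst_def)

lemma clinear_lam: "clinear lam"
  by (rule clinearI) (simp_all add: lam_add lam_scaleC)

lemma pev_mu: "pev (mu p) z = lam (pev p z)"
  using pev_map_poly[OF clinear_lam, of p z] by (simp add: mu_def lam_def)

lemma pev_complex: "pev p z = poly p z" for p :: "complex poly"
proof -
  have "((*\<^sub>C) z ^^ k) x = z ^ k * x" for k and x :: complex
    by (induction k) (simp_all add: scaleC_complex_def)
  then show ?thesis
    by (simp add: pev_def psubst_def poly_altdef mult.commute)
qed

section \<open>Separation of points\<close>

lemma hamel_basis_exists:
  obtains E :: "'v::complex_vector set" where "cv.independent E" "cv.span E = UNIV"
  using cv.independent_extend_basis[OF cv.independent_empty]
    cv.span_extend_basis[OF cv.independent_empty]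
  by metis

lemma clinear_representation:
  assumes "cv.independent E" "cv.span E = UNIV"
  shows "clinear (\<lambda>v. cv.representation E v e)"
  by (rule clinearI)
    (simp_all add: cv.representation_add cv.representation_scale assms scaleC_complex_def)

text \<open>Coordinates in a Hamel basis turn \<open>p\<close> into complex polynomials that vanish
  everywhere and hence are zero, so every coordinate of every coefficient vanishes.\<close>

lemma poly_zero_by_pev:
  fixes p :: "'v::complex_vector poly"
  assumes "\<And>z. pev p z = 0"
  shows "p = 0"
proof (rule poly_eqI)
  fix k
  obtain E :: "'v set" where E: "cv.independent E" "cv.span E = UNIV"
    by (rule hamel_basis_exists)
  note rep = clinear_representation[OF E]
  have "map_poly (\<lambda>v. cv.representation E v e) p = 0" for e
  proof -
    have "poly (map_poly (\<lambda>v. cv.representation E v e) p) z = 0" for z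
      using pev_map_poly[OF rep, of e p z] by (simp add: assms pev_complex clinearD[OF rep])
    then show ?thesis using poly_all_0_iff_0 by blast
  qed
  then have "cv.representation E (coeff p k) e = 0" for e
    by (metis coeff_map_poly coeff_0 clinearD(3)[OF rep])
  then show "coeff p k = coeff 0 k"
    using cv.sum_nonzero_representation_eq[OF E(1), of "coeff p k"] by (simp add: E)
qed

lemma poly_eq_by_pev:
  fixes p q :: "'v::complex_vector poly"
  assumes "\<And>z. pev p z = pev q z"
  shows "p = q"
  using poly_zero_by_pev[of "p - q"] assms by (simp add: pev_linear)

lemma poly_eq_iff_pev: "p = q \<longleftrightarrow> (\<forall>z. pev p z = pev q z)" for p q :: "'v::complex_vector poly"
  by (metis poly_eq_by_pev)

section \<open>Conformal linear maps at a fixed value of the parameter\<close>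

lemma clinear_app: "clinear (app F)"
  using app[of F] by simp

lemma app_dop: "app F (\<partial> u) = (\<partial> + lam) (app F u)"
  using app[of F] by simp

lemma clinear_app_left: "clinear (\<lambda>F. app F u)"
  by (rule clinearI) (simp_all add: plus_chom.rep_eq scaleC_chom.rep_eq)

lemma chom_eqI: "(\<And>u. app F u = app G u) \<Longrightarrow> F = G"
  by (metis app_inject ext)

abbreviation capp :: "('u::conf_module, 'v::conf_module) chom \<Rightarrow> complex \<Rightarrow> 'u \<Rightarrow> 'v"
  where "capp F z u \<equiv> pev (app F u) z"

lemma clinear_capp: "clinear (capp F z)" "clinear (\<lambda>F. capp F z u)"
  by (rule clinear_compose[OF clinear_pev], rule clinear_app clinear_app_left)+

lemmas capp_linear = clinearD[OF clinear_capp(1)]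
lemmas capp_linear_left = clinearD[OF clinear_capp(2)]

text \<open>For an element of the dual the first summand vanishes, since \<open>\<partial>\<close>
  is zero on \<open>complex\<close>; this is how \<open>\<partial>\<close> becomes a number.\<close>

lemma capp_dop: "capp F z (\<partial> u) = \<partial> (capp F z u) + z *\<^sub>C capp F z u"
  by (simp add: app_dop pev_linear pev_dop pev_lam)

lemma capp_dop_left: "capp (\<partial> F) z u = - (z *\<^sub>C capp F z u)"
  by (simp add: dop_chom.rep_eq pev_linear pev_lam)

lemma chom_eq_iff_capp: "F = G \<longleftrightarrow> (\<forall>z u. capp F z u = capp G z u)"
  by (metis chom_eqI poly_eq_by_pev)

lemma dop_complex [simp]: "\<partial> (z::complex) = 0"
  by (simp add: dop_complex_def)

lemma scaleC_complex [simp]: "c *\<^sub>C (z::complex) = c * z"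
  by (simp add: scaleC_complex_def)

interpretation pm: module "pact :: complex poly \<Rightarrow> 'a::conf_module \<Rightarrow> 'a"
  by (rule module_pact)

lemma pact_const: "pact [:c:] x = c *\<^sub>C x"
  by (simp add: pact_pCons pact_0 dop_linear)

lemma pact_X: "pact [:0, 1:] x = \<partial> x"
  by (simp add: pact_pCons pact_0 dop_linear scaleC_one)

text \<open>Constants and the variable generate \<complex>[\<partial>]; induction along
  \<open>pCons\<close> recovers the action of every polynomial.\<close>

lemma module_hom_pact_iff:
  "module_hom pact pact h \<longleftrightarrow> clinear h \<and> (\<forall>x. h (\<partial> x) = \<partial> (h x))"
  for h :: "'a::conf_module \<Rightarrow> 'b::conf_module"
proof
  assume "module_hom pact pact h"
  then interpret module_hom pact pact h .
  show "clinear h \<and> (\<forall>x. h (\<partial> x) = \<partial> (h x))"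
    by (metis clinearI add scale pact_const pact_X)
next
  assume h: "clinear h \<and> (\<forall>x. h (\<partial> x) = \<partial> (h x))"
  have "h (pact p x) = pact p (h x)" for p x
    using h by (induction p) (simp_all add: pact_0 pact_pCons clinearD)
  then show "module_hom pact pact h"
    using h by (simp add: module_hom_def module_hom_axioms_def clinearD module_pact)
qed

text \<open>Coordinates in a basis over \<complex>[\<partial>] are polynomials in \<partial>.
  Reading the variable as \<lambda> makes each coordinate map an element of the conformal
  dual.\<close>

lemma cdual_separates:
  fixes v :: "'a::conf_module"
  assumes free: "\<exists>B::'a set. \<not> module.dependent pact B \<and> module.span pact B = UNIV"
    and zero: "\<And>(f :: 'a cdual) z. capp f z v = 0"
  shows "v = 0"
proof -
  obtain B :: "'a set" where B: "pm.independent B" "pm.span B = UNIV"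
    using free by blast
  let ?r = "\<lambda>b v. pm.representation B v b"
  have "?r b v = 0" for b
  proof -
    have "?r b (c *\<^sub>C x) = c *\<^sub>C ?r b x" for c x
      using pm.representation_scale[OF B(1), of x "[:c:]"]
      by (simp add: B pact_const poly_eq_iff coeff_scaleC)
    \<comment> \<open>Multiplying by \<open>[:0,1:]\<close> is \<open>lam\<close>; the added
      \<open>\<partial>\<close> acts as zero on complex coefficients.\<close>
    moreover have "?r b (\<partial> x) = (\<partial> + lam) (?r b x)" for x
      using pm.representation_scale[OF B(1), of x "[:0,1:]"]
      by (simp add: B pact_X poly_eq_iff coeff_dop lam_def)
    ultimately have "app (Abs_chom (?r b)) = ?r b"
      by (intro Abs_chom_inverse CollectI conjI clinearI allI)
        (simp_all add: B pm.representation_add)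
    with zero[of "Abs_chom (?r b)"] show "?r b v = 0"
      by (metis poly_zero_by_pev)
  qed
  then show ?thesis
    using pm.sum_nonzero_representation_eq[OF B(1), of v] by (simp add: B)
qed

section \<open>Tensor products and their separation by pairs of dual elements\<close>

lemma tlift_comp: "clinear h \<Longrightarrow> h (tlift f t) = tlift (\<lambda>x y. h (f x y)) t"
  by (simp add: tlift_def free_lift_def clinearD case_prod_unfold)

text \<open>Scalars move into the left factor, so closure under sums is enough; the induction adds
  one key of the representative at a time.\<close>

lemma tensor_induct [case_names tens add]:
  assumes "\<And>x y. P (x \<otimes>\<^sub>t y)" "\<And>s t. P s \<Longrightarrow> P t \<Longrightarrow> P (s + t)"
  shows "P t"
proof (induction t)
  case (1 r)
  have single: "P (abs_tensor (Poly_Mapping.single i c))" for i c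
  proof -
    obtain x y where "i = (x, y)" by (cases i)
    moreover have "Poly_Mapping.single (x, y) c = c *\<^sub>C Poly_Mapping.single (x, y) 1"
      by (rule poly_mapping_eqI) (simp add: lookup_scaleC lookup_single when_def)
    ultimately have "abs_tensor (Poly_Mapping.single i c) = (c *\<^sub>C x) \<otimes>\<^sub>t y"
      by (simp only: tens_scaleC_left tens.abs_eq[symmetric] scaleC_tensor.abs_eq[symmetric])
    then show ?thesis
      using assms(1) by simp
  qed
  show ?case
  proof (induction r rule: update_induct)
    case const
    then show ?case
      using single[of undefined 0] by simp
  next
    case (update r i c)
    \<comment> \<open>The key \<open>i\<close> is fresh for \<open>r\<close>, so updating there
      amounts to adding.\<close>
    have "Poly_Mapping.update i c r = r + Poly_Mapping.single i c"
      using update(1)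
      by (intro poly_mapping_eqI) (auto simp: lookup_add lookup_single lookup_update in_keys_iff when_def)
    then show ?case
      using assms(2)[OF update(3) single] by (simp add: plus_tensor.abs_eq)
  qed
qed

text \<open>Left factors are expanded in \<open>E\<close>, leaving one right factor per basis
  vector. For a sum, both families are extended by zero to \<open>I \<union> J\<close>.\<close>

lemma tensor_decomposition:
  fixes t :: "'a::complex_vector \<otimes> 'b::complex_vector"
  assumes E: "cv.independent E" "cv.span E = UNIV"
  shows "\<exists>I y. finite I \<and> I \<subseteq> E \<and> t = (\<Sum>e\<in>I. e \<otimes>\<^sub>t y e)"
proof (induction t rule: tensor_induct)
  case (tens x y)
  let ?I = "{e. cv.representation E x e \<noteq> 0}"
  have "x \<otimes>\<^sub>t y = (\<Sum>e\<in>?I. cv.representation E x e *\<^sub>C e) \<otimes>\<^sub>t y"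
    by (simp add: cv.sum_nonzero_representation_eq E)
  also have "\<dots> = (\<Sum>e\<in>?I. e \<otimes>\<^sub>t (cv.representation E x e *\<^sub>C y))"
    by (simp add: clinearD(6)[OF tens_bilinear(2)] tens_scaleC_left tens_scaleC_right)
  finally show ?case
    by (intro exI conjI) (auto simp: cv.finite_representation dest: cv.representation_ne_zero)
next
  case (add s t)
  obtain I y where s: "finite I" "I \<subseteq> E" "s = (\<Sum>e\<in>I. e \<otimes>\<^sub>t y e)"
    using add(1) by blast
  obtain J z where t: "finite J" "J \<subseteq> E" "t = (\<Sum>e\<in>J. e \<otimes>\<^sub>t z e)"
    using add(2) by blast
  let ?y = "\<lambda>e. if e \<in> I then y e else 0" and ?z = "\<lambda>e. if e \<in> J then z e else 0"
  have "s = (\<Sum>e\<in>I \<union> J. e \<otimes>\<^sub>t ?y e)" unfolding s(3)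
    by (rule sum.mono_neutral_cong_left) (auto simp: s t clinearD[OF tens_bilinear(1)])
  moreover have "t = (\<Sum>e\<in>I \<union> J. e \<otimes>\<^sub>t ?z e)" unfolding t(3)
    by (rule sum.mono_neutral_cong_left) (auto simp: s t clinearD[OF tens_bilinear(1)])
  ultimately have "s + t = (\<Sum>e\<in>I \<union> J. e \<otimes>\<^sub>t (?y e + ?z e))"
    by (simp add: sum.distrib tens_add_right)
  then show ?case
    using s t by (intro exI[of _ "I \<union> J"] exI[of _ "\<lambda>e. ?y e + ?z e"]) simp
qed

definition tpair ::
  "'a::conf_module cdual \<Rightarrow> complex \<Rightarrow> 'b::conf_module cdual \<Rightarrow> complex \<Rightarrow> 'a \<otimes> 'b \<Rightarrow> complex"
  where "tpair f \<alpha> g \<beta> = tlift (\<lambda>x y. capp f \<alpha> x * capp g \<beta> y)"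

lemma clinear_mult:
  "clinear f \<Longrightarrow> clinear (\<lambda>x. c * f x :: complex)"
  "clinear f \<Longrightarrow> clinear (\<lambda>x. f x * c :: complex)"
  by (rule clinearI; simp add: clinearD algebra_simps)+

lemma clinear_tpair: "clinear (tpair f \<alpha> g \<beta>)"
  unfolding tpair_def by (intro clinear_tlift clinear_mult clinear_capp)

lemmas tpair_linear = clinearD[OF clinear_tpair]

lemma tpair_tens: "tpair f \<alpha> g \<beta> (x \<otimes>\<^sub>t y) = capp f \<alpha> x * capp g \<beta> y"
  unfolding tpair_def by (intro tlift_tens clinear_mult clinear_capp)

lemma clinear_eq_on_tensor:
  assumes "clinear F" "clinear G" "\<And>x y. F (x \<otimes>\<^sub>t y) = G (x \<otimes>\<^sub>t y)"
  shows "F t = G t"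
  by (induction t rule: tensor_induct) (simp_all add: assms clinearD[OF assms(1)]
      clinearD[OF assms(2)])

text \<open>Write \<open>t\<close> with independent left factors \<open>e\<close>. Applying
  \<open>g\<close> to the right factors gives a vector killed by all \<open>f\<close>, hence zero;
  independence makes each value of \<open>g\<close> on \<open>y e\<close> zero, and freeness of the
  second module gives \<open>y e = 0\<close>.\<close>

lemma tpair_separates:
  fixes t :: "'a::conf_module \<otimes> 'b::conf_module"
  assumes freeA: "\<exists>B::'a set. \<not> module.dependent pact B \<and> module.span pact B = UNIV"
    and freeB: "\<exists>B::'b set. \<not> module.dependent pact B \<and> module.span pact B = UNIV"
    and zero: "\<And>f \<alpha> g \<beta>. tpair f \<alpha> g \<beta> t = 0"
  shows "t = 0"
proof -
  obtain E :: "'a set" where E: "cv.independent E" "cv.span E = UNIV"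
    by (rule hamel_basis_exists)
  obtain I y where I: "finite I" "I \<subseteq> E" and t: "t = (\<Sum>e\<in>I. e \<otimes>\<^sub>t y e)"
    using tensor_decomposition[OF E] by blast
  have "y e = 0" if "e \<in> I" for e
  proof (rule cdual_separates[OF freeB])
    fix g :: "'b cdual" and \<beta>
    have "(\<Sum>e\<in>I. capp g \<beta> (y e) *\<^sub>C e) = 0"
    proof (rule cdual_separates[OF freeA])
      fix f :: "'a cdual" and \<alpha>
      show "capp f \<alpha> (\<Sum>e\<in>I. capp g \<beta> (y e) *\<^sub>C e) = 0"
        using zero[of f \<alpha> g \<beta>] by (simp add: t tpair_linear tpair_tens capp_linear mult.commute)
    qed
    then show "capp g \<beta> (y e) = 0"
      using cv.independentD[OF cv.independent_mono[OF E(1) I(2)] I(1) order_refl,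
          of "\<lambda>e. capp g \<beta> (y e)"] that
      by simp
  qed
  then show ?thesis
    by (simp add: t clinearD[OF tens_bilinear(1)])
qed

section \<open>Evaluation of \<open>\<lambda>\<close>-products\<close>

definition pev_at :: "('v \<Rightarrow> 'v) \<Rightarrow> 'v poly \<Rightarrow> 'v::complex_vector"
  where "pev_at S = psubst id S"

lemma clinear_pev_at: "clinear S \<Longrightarrow> clinear (pev_at S)"
  unfolding pev_at_def by (intro clinear_psubst clinear_id)

lemma pev_at_scaleC: "pev_at (scaleC z) p = pev p z"
  by (simp add: pev_at_def pev_def)

text \<open>The operator \<open>- lam - \<partial>\<close> once \<lambda> has the value
  \<open>z\<close>.\<close>

definition dshift :: "complex \<Rightarrow> 'v::conf_module \<Rightarrow> 'v"
  where "dshift z v = - (z *\<^sub>C v) - \<partial> v"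

lemma clinear_dshift: "clinear (dshift z)"
  by (rule clinearI) (simp_all add: dshift_def dop_linear cv.scale_right_diff_distrib
      scaleC_add_right scaleC_scaleC mult.commute)

text \<open>The mechanism behind every replacement of \<partial> by a number: a map that sees
  \<open>S\<close> as the scalar \<open>s\<close> sees the substitution of \<open>S\<close> as
  evaluation at \<open>s\<close>.\<close>

lemma clinear_map_pev_at:
  assumes "clinear h" "\<And>x. h (S x) = s *\<^sub>C h x"
  shows "h (pev_at S p) = h (pev p s)"
  unfolding pev_at_def pev_def
  by (subst (1 2) psubst_comm[where h = h and S = "scaleC s"]) (simp_all add: assms clinearD[OF assms(1)])

definition ev2 :: "'v::complex_vector poly poly \<Rightarrow> complex \<Rightarrow> complex \<Rightarrow> 'v"
  where "ev2 P l m = pev (pev P l) m"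

lemma clinear_ev2: "clinear (\<lambda>P. ev2 P l m)"
  unfolding ev2_def by (rule clinear_compose[OF clinear_pev clinear_pev])

lemmas ev2_linear = clinearD[OF clinear_ev2]

lemma ev2_cst2 [simp]: "ev2 \<lbrakk>v\<rbrakk> l m = v"
  by (simp add: ev2_def)

lemma ev2_lam: "ev2 (lam P) l m = l *\<^sub>C ev2 P l m"
  by (simp add: ev2_def pev_lam pev_linear)

lemma ev2_mu: "ev2 (mu P) l m = m *\<^sub>C ev2 P l m"
  by (simp add: ev2_def pev_mu pev_lam)

lemma ev2_dop: "ev2 (\<partial> P) l m = \<partial> (ev2 P l m)"
  by (simp add: ev2_def pev_dop)

lemma poly2_eq_iff_ev2: "P = Q \<longleftrightarrow> (\<forall>l m. ev2 P l m = ev2 Q l m)"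
  unfolding ev2_def by (metis poly_eq_by_pev)

lemma pev_sum: "pev p z = (\<Sum>k\<le>degree p. z ^ k *\<^sub>C coeff p k)"
proof -
  have "((*\<^sub>C) z ^^ k) x = z ^ k *\<^sub>C x" for k and x :: 'a
    by (induction k) (simp_all add: scaleC_one scaleC_scaleC)
  then show ?thesis
    by (simp add: pev_def psubst_def)
qed

lemma ev2_sum:
  "ev2 P l m = (\<Sum>i\<le>degree P. \<Sum>j\<le>degree (coeff P i). (l ^ i * m ^ j) *\<^sub>C coeff (coeff P i) j)"
  by (simp add: ev2_def pev_sum[of P] pev_linear)
    (simp add: pev_sum cv.scale_sum_right scaleC_scaleC)

text \<open>Algebra products, bimodule actions and \<open>app\<close> all obey these rules, so
  evaluation is treated once for all of them.\<close>

definition conf_bilinear :: "('a::conf_module \<Rightarrow> 'b::conf_module \<Rightarrow> 'c::conf_module poly) \<Rightarrow> bool"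
  where "conf_bilinear f \<longleftrightarrow> (\<forall>a. clinear (f a)) \<and> (\<forall>b. clinear (\<lambda>a. f a b)) \<and>
    (\<forall>a b. f (\<partial> a) b = - lam (f a b)) \<and> (\<forall>a b. f a (\<partial> b) = (\<partial> + lam) (f a b))"

text \<open>Bilinearity absorbs the monomials in \<lambda> and \<mu> into the arguments as their
  values at \<open>l\<close> and \<open>m\<close>. What is left is \<open>T\<close>, which acts at
  this point as \<open>S\<close>.\<close>

lemma ev2_act:
  assumes f: "conf_bilinear f" and T: "\<And>X. ev2 (T X) l m = S (ev2 X l m)" and S: "clinear S"
  shows "ev2 (act f T P Q) l m = pev_at S (f (ev2 P l m) (ev2 Q l m))"
proof -
  let ?B = "\<lambda>x y. pev_at S (f x y)"
  have l: "clinear (f a)" and r: "clinear (\<lambda>a. f a b)" for a b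
    using f by (auto simp: conf_bilinear_def)
  have B: "clinear (?B x)" "clinear (\<lambda>x. ?B x y)" for x y
    by (rule clinear_compose[OF clinear_pev_at[OF S]], rule l r)+
  have lam: "ev2 ((lam ^^ n) X) l m = l ^ n *\<^sub>C ev2 X l m" for n X
    by (induction n) (simp_all add: ev2_lam scaleC_one scaleC_scaleC)
  have mu: "ev2 ((mu ^^ n) X) l m = m ^ n *\<^sub>C ev2 X l m" for n X
    by (induction n) (simp_all add: ev2_mu scaleC_one scaleC_scaleC)
  have sub: "ev2 (psubst (\<lambda>v. \<lbrakk>v\<rbrakk>) T p) l m = pev_at S p" for p
    using psubst_comm[where h = "\<lambda>P. ev2 P l m", OF clinear_ev2,
        of T S "\<lambda>v. \<lbrakk>v\<rbrakk>" p] T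
    by (simp add: pev_at_def id_def)
  have "ev2 (act f T P Q) l m = (\<Sum>i\<le>degree P. \<Sum>j\<le>degree (coeff P i). \<Sum>k\<le>degree Q.
      \<Sum>n\<le>degree (coeff Q k). (l ^ (i + k) * m ^ (j + n)) *\<^sub>C
        ?B (coeff (coeff P i) j) (coeff (coeff Q k) n))"
    by (simp add: act_def ev2_linear lam mu sub scaleC_scaleC)
  also have "\<dots> = ?B (ev2 P l m) (ev2 Q l m)"
    by (simp add: ev2_sum[of P] clinearD[OF B(2)])
      (simp add: ev2_sum[of Q] clinearD[OF B(1)] cv.scale_sum_right scaleC_scaleC power_add mult_ac)
  finally show ?thesis .
qed

lemma ev2_act_scalar:
  assumes "conf_bilinear f" "\<And>X. ev2 (T X) l m = z *\<^sub>C ev2 X l m"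
  shows "ev2 (act f T P Q) l m = pev (f (ev2 P l m) (ev2 Q l m)) z"
  using ev2_act[OF assms clinear_scaleC] by (simp add: pev_at_scaleC)

text \<open>One rule for each subscript in the definitions of algebras, bimodules, matched pairs and
  duals.\<close>

lemma ev2_acts:
  assumes "conf_bilinear f"
  shows "ev2 (act f lam P Q) l m = pev (f (ev2 P l m) (ev2 Q l m)) l"
    and "ev2 (act f mu P Q) l m = pev (f (ev2 P l m) (ev2 Q l m)) m"
    and "ev2 (act f (lam + mu) P Q) l m = pev (f (ev2 P l m) (ev2 Q l m)) (l + m)"
    and "ev2 (act f (lam - mu) P Q) l m = pev (f (ev2 P l m) (ev2 Q l m)) (l - m)"
    and "ev2 (act f (mu - lam) P Q) l m = pev (f (ev2 P l m) (ev2 Q l m)) (m - l)"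
    and "ev2 (act f (- mu) P Q) l m = pev (f (ev2 P l m) (ev2 Q l m)) (- m)"
    and "ev2 (act f (- lam - \<partial>) P Q) l m = pev_at (dshift l) (f (ev2 P l m) (ev2 Q l m))"
    and "ev2 (act f (- mu - \<partial>) P Q) l m = pev_at (dshift m) (f (ev2 P l m) (ev2 Q l m))"
    and "ev2 (act f (- lam - mu - \<partial>) P Q) l m = pev_at (dshift (l + m)) (f (ev2 P l m) (ev2 Q l m))"
  by (rule ev2_act_scalar[OF assms] ev2_act[OF assms _ clinear_dshift];
    simp add: dshift_def ev2_linear ev2_lam ev2_mu ev2_dop scaleC_add_left cv.scale_left_diff_distrib
      algebra_simps)+

lemma conf_bilinear_app: "conf_bilinear app"
  by (simp add: conf_bilinear_def clinear_app clinear_app_left app_dop dop_chom.rep_eq)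

lemma conf_bilinear_module_hom: "module_hom pact pact l \<Longrightarrow> conf_bilinear (\<lambda>a. app (l a))"
  using clinear_compose[OF clinear_app_left, of l]
  by (simp add: module_hom_pact_iff conf_bilinear_def clinear_app app_dop dop_chom.rep_eq)

lemma conf_bilinear_algebra: "assoc_conf_algebra m \<Longrightarrow> conf_bilinear m"
  by (simp add: assoc_conf_algebra_def conf_bilinear_def)

lemma clinear_pev_bilinear:
  assumes "conf_bilinear f"
  shows "clinear (\<lambda>b. pev (f a b) z)" "clinear (\<lambda>a. pev (f a b) z)"
  using assms by (auto simp: conf_bilinear_def intro!: clinear_compose[OF clinear_pev])

lemma pev_bilinear_dop:
  assumes "conf_bilinear f"
  shows "pev (f (\<partial> a) b) z = - (z *\<^sub>C pev (f a b) z)"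
    and "pev (f a (\<partial> b)) z = \<partial> (pev (f a b) z) + z *\<^sub>C pev (f a b) z"
  using assms by (simp_all add: conf_bilinear_def pev_linear pev_lam pev_dop)

lemma assoc_pev:
  assumes "assoc_conf_algebra m"
  shows "pev (m (pev (m a b) y) c) (y + z) = pev (m a (pev (m b c) z)) y"
proof -
  have "act m (lam + mu) (act m lam \<lbrakk>a\<rbrakk> \<lbrakk>b\<rbrakk>) \<lbrakk>c\<rbrakk> = act m lam \<lbrakk>a\<rbrakk> (act m mu \<lbrakk>b\<rbrakk> \<lbrakk>c\<rbrakk>)"
    using assms by (simp add: assoc_conf_algebra_def)
  from arg_cong[OF this, of "\<lambda>P. ev2 P y z"] show ?thesis
    by (simp add: ev2_acts[OF conf_bilinear_algebra[OF assms]])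
qed

section \<open>Multiplication operators, and functionals applied to substituted products\<close>

lemma app_Lmul:
  assumes "conf_bilinear m"
  shows "app (Lmul m a) b = m a b"
  using assms by (simp add: Lmul_def conf_bilinear_def Abs_chom_inverse)

lemma pev_psubst_cst:
  "pev (psubst cst (- lam - \<partial>) p) z = pev_at (dshift z) p"
  unfolding pev_at_def
  by (subst psubst_comm[OF clinear_pev, where S = "dshift z"])
    (simp_all add: dshift_def pev_linear pev_lam pev_dop id_def)

lemma pev_at_lam: "clinear S \<Longrightarrow> pev_at S (lam p) = S (pev_at S p)"
  unfolding pev_at_def by (intro psubst_lam clinear_id)

text \<open>A factor \<open>- \<nu>\<close> comes out of \<open>\<partial> b\<close> in the left
  argument; substituting \<open>- \<lambda> - \<partial>\<close> for \<open>\<nu>\<close> turns it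
  into \<open>\<partial> + \<lambda>\<close>, as membership in \<open>chom\<close> demands.\<close>

lemma app_Rmul:
  assumes m: "conf_bilinear m"
  shows "app (Rmul m a) b = psubst cst (- lam - \<partial>) (m b a)"
proof -
  have r: "clinear (\<lambda>b. m b a)"
    using m by (simp add: conf_bilinear_def)
  note lin = clinearD[OF clinear_compose[OF clinear_pev_at[OF clinear_dshift] r]]
  have "clinear (\<lambda>b. psubst cst (- lam - \<partial>) (m b a))"
    by (rule clinearI; rule poly_eq_by_pev; simp add: pev_linear pev_psubst_cst lin)
  moreover have "psubst cst (- lam - \<partial>) (m (\<partial> b) a) = (\<partial> + lam) (psubst cst (- lam - \<partial>) (m b a))" for b
    using m
    by (intro poly_eq_by_pev)
      (simp add: conf_bilinear_def pev_linear pev_psubst_cst pev_lam pev_dop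
        clinearD[OF clinear_pev_at[OF clinear_dshift]] pev_at_lam[OF clinear_dshift] dshift_def)
  ultimately show ?thesis
    by (simp add: Rmul_def Abs_chom_inverse)
qed

lemma capp_pev_at:
  "capp f z (pev_at (dshift y) p) = capp f z (pev p (- y - z))" for f :: "'a::conf_module cdual"
  by (rule clinear_map_pev_at[OF clinear_capp(1)])
    (simp add: dshift_def capp_linear capp_dop algebra_simps)

text \<open>On the dual, \<partial> acts as \<open>- z\<close> under evaluation at
  \<open>z\<close>.\<close>

lemma capp_pev_at_left:
  "capp (pev_at (dshift y) p) z a = capp (pev p (z - y)) z a" for a :: "'a::conf_module" and p :: "'a cdual poly"
  by (rule clinear_map_pev_at[OF clinear_capp(2), where S = "dshift y"])
    (simp add: dshift_def capp_linear_left capp_dop_left algebra_simps)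

text \<open>Inside a product with subscript \<open>k\<close>, \<partial> on the right factor counts
  as \<open>z + k\<close> and on the left factor as \<open>- k\<close>.\<close>

lemma capp_bilinear_pev_at:
  fixes f :: "'a::conf_module cdual"
  assumes "conf_bilinear m"
  shows "capp f z (pev (m a (pev_at (dshift y) p)) k) = capp f z (pev (m a (pev p (- y - z - k))) k)"
    and "capp f z (pev (m (pev_at (dshift y) p) a) k) = capp f z (pev (m (pev p (k - y)) a) k)"
  by (rule
      clinear_map_pev_at[where h = "\<lambda>x. capp f z (pev (m a x) k)",
        OF clinear_compose[OF clinear_capp(1) clinear_pev_bilinear(1)[OF assms]]]
      clinear_map_pev_at[where h = "\<lambda>x. capp f z (pev (m x a) k)",
        OF clinear_compose[OF clinear_capp(1) clinear_pev_bilinear(2)[OF assms]]],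
      simp add: dshift_def capp_linear capp_dop algebra_simps pev_bilinear_dop[OF assms]
        clinearD[OF clinear_pev_bilinear(1)[OF assms]]
        clinearD[OF clinear_pev_bilinear(2)[OF assms]])+

section \<open>Conformal duals\<close>

lemma pev_bound:
  assumes "degree p \<le> N"
  shows "pev p z = (\<Sum>k\<le>N. z ^ k *\<^sub>C coeff p k)"
  unfolding pev_sum by (rule sum.mono_neutral_left) (use assms in \<open>auto simp: coeff_eq_0\<close>)

lemma pev_monom: "pev (monom v k) z = z ^ k *\<^sub>C v"
  by (subst pev_bound[OF degree_monom_le]) (simp add: if_distrib[of "scaleC _"] cong: if_cong)

text \<open>The degree in \<lambda> could vary with \<open>v\<close>. It is bounded on a finite
  generating set, and the bound survives the module operations, so finitely many coefficients in
  \<lambda> suffice; each is conformal linear in \<open>v\<close>.\<close>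

lemma cdual_poly_exists:
  fixes F :: "'v::conf_module cend" and f :: "'v cdual"
  assumes fg: "\<exists>S::'v set. finite S \<and> module.span pact S = UNIV"
  shows "\<exists>p. \<forall>z n v. capp (pev p z) n v = capp f (n - z) (capp F z v)"
proof -
  define H where "H = (\<lambda>v. act app (mu - lam) \<lbrakk>f\<rbrakk> (act app lam \<lbrakk>F\<rbrakk> \<lbrakk>v\<rbrakk>))"
  have H: "ev2 (H v) z n = capp f (n - z) (capp F z v)" for v z n
    by (simp add: H_def ev2_acts[OF conf_bilinear_app])
  have lin: "clinear H"
    by (rule clinearI; subst poly2_eq_iff_ev2; simp add: H ev2_linear capp_linear)
  \<comment> \<open>\<open>F\<close> contributes \<open>z\<close> and \<open>f\<close> contributes
    \<open>n - z\<close>, so \<partial> becomes multiplication by \<mu> alone.\<close>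
  have dop: "H (\<partial> v) = mu (H v)" for v
    by (subst poly2_eq_iff_ev2) (simp add: H ev2_mu capp_linear capp_dop algebra_simps)
  obtain S :: "'v set" where S: "finite S" "pm.span S = UNIV"
    using fg by blast
  \<comment> \<open>The inserted 0 covers an empty generating set.\<close>
  define N where "N = Max (insert 0 ((\<lambda>v. degree (H v)) ` S))"
  let ?D = "{v. degree (H v) \<le> N}"
  have scale: "c *\<^sub>C v \<in> ?D" if "v \<in> ?D" for c v
  proof -
    have "degree (c *\<^sub>C H v) \<le> degree (H v)"
      by (rule degree_le) (simp add: coeff_scaleC coeff_eq_0)
    then show ?thesis
      using that by (simp add: clinearD[OF lin])
  qed
  have add: "v + w \<in> ?D" if "v \<in> ?D" "w \<in> ?D" for v w
    using that by (simp add: clinearD[OF lin] degree_add_le)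
  \<comment> \<open>\<open>mu\<close> acts on the inner variable and cannot raise the degree in
    \<lambda>.\<close>
  have dopD: "\<partial> v \<in> ?D" if "v \<in> ?D" for v
  proof -
    have "degree (mu (H v)) \<le> degree (H v)"
      by (rule degree_le) (simp add: mu_def coeff_map_poly coeff_eq_0)
    then show ?thesis
      using that by (simp add: dop)
  qed
  have zero: "0 \<in> ?D"
    by (simp add: clinearD[OF lin])
  have "pact p v \<in> ?D" if "v \<in> ?D" for p v
  proof (induction p)
    case 0
    show ?case using zero by (simp only: pact_0)
  next
    case (pCons c p)
    show ?case unfolding pact_pCons by (rule add[OF scale[OF that] dopD[OF pCons(2)]])
  qed
  with zero add have "pm.subspace ?D"
    by (intro pm.subspaceI)
  moreover have "S \<subseteq> ?D"
    using S(1) by (auto simp: N_def)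
  ultimately have deg: "degree (H v) \<le> N" for v
    using pm.span_minimal[of S ?D] S(2) by auto
  define G where "G = (\<lambda>k. Abs_chom (\<lambda>v. coeff (H v) k) :: 'v cdual)"
  \<comment> \<open>\<open>\<partial>\<close> is zero on complex polynomials, which gives
    \<open>mu\<close> the form that \<open>chom\<close> requires.\<close>
  have "coeff (mu P) k = (\<partial> + lam) (coeff P k)" for P :: "complex poly poly" and k
    by (simp add: mu_def coeff_map_poly lam_def poly_eq_iff coeff_dop)
  then have G: "app (G k) v = coeff (H v) k" for k v
    unfolding G_def
    by (subst Abs_chom_inverse) (auto intro!: clinearI simp: clinearD[OF lin] coeff_scaleC dop)
  have "capp (pev (\<Sum>k\<le>N. monom (G k) k) z) n v = capp f (n - z) (capp F z v)" for z n v
    using pev_bound[OF deg, of v z]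
    by (simp add: H[symmetric] ev2_def pev_linear pev_monom capp_linear_left G)
  then show ?thesis by blast
qed

text \<open>Justifies the definite description. The polynomial chosen for each \<open>f\<close> has
  prescribed values, so the choice is automatically linear in \<open>f\<close>, and the same values
  force uniqueness.\<close>

lemma capp_cdual_map:
  fixes F :: "'v::conf_module cend" and f :: "'v cdual"
  assumes fg: "\<exists>S::'v set. finite S \<and> module.span pact S = UNIV"
  shows "capp (capp (cdual_map F) z f) n v = capp f (n - z) (capp F z v)"
proof -
  let ?P = "\<lambda>G. \<forall>(f :: 'v cdual) v. act app mu (act app lam \<lbrakk>G\<rbrakk> \<lbrakk>f\<rbrakk>) \<lbrakk>v\<rbrakk>
    = act app (mu - lam) \<lbrakk>f\<rbrakk> (act app lam \<lbrakk>F\<rbrakk> \<lbrakk>v\<rbrakk>)"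
  have P_iff: "?P G \<longleftrightarrow> (\<forall>(f :: 'v cdual) v z n. capp (capp G z f) n v = capp f (n - z) (capp F z v))" for G
    by (simp add: poly2_eq_iff_ev2 ev2_acts[OF conf_bilinear_app])
  define g where "g = (\<lambda>f :: 'v cdual. SOME p. \<forall>z n v. capp (pev p z) n v = capp f (n - z) (capp F z v))"
  have g: "capp (pev (g f) z) n v = capp f (n - z) (capp F z v)" for f :: "'v cdual" and z n v
    using someI_ex[OF cdual_poly_exists[OF fg, of f F]] by (simp add: g_def)
  have "clinear g"
    by (rule clinearI; rule poly_eq_by_pev; subst chom_eq_iff_capp;
        simp add: pev_linear g capp_linear_left)
  moreover have "g (\<partial> f) = (\<partial> + lam) (g f)" for f :: "'v cdual"
    by (rule poly_eq_by_pev, subst chom_eq_iff_capp)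
      (simp add: g pev_linear pev_dop pev_lam capp_linear_left capp_dop_left algebra_simps)
  ultimately have app_g: "app (Abs_chom g) = g"
    by (simp add: Abs_chom_inverse)
  have ex: "?P (Abs_chom g)"
    by (simp only: P_iff app_g g) simp
  have "G = Abs_chom g" if "?P G" for G
    using that ex unfolding P_iff chom_eq_iff_capp by metis
  with ex have "?P (cdual_map F)"
    unfolding cdual_map_def by (rule theI[of ?P])
  then show ?thesis
    unfolding P_iff by blast
qed

text \<open>Existence is supplied by an explicit \<open>F\<close>, uniqueness by separation of
  points. The parameter \<open>n\<close> stands for \<open>- \<mu>\<close>.\<close>

lemma cpredual_mapI:
  fixes F :: "'v::conf_module cend"
  assumes free: "\<exists>B::'v set. \<not> module.dependent pact B \<and> module.span pact B = UNIV"
    and F: "\<And>(h :: 'v cdual) n z v. capp h n (capp F z v) = capp (capp G z h) (z + n) v"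
  shows "cpredual_map G = F"
  unfolding cpredual_map_def
proof (rule the_equality)
  let ?P = "\<lambda>F. \<forall>(h :: 'v cdual) v. act app (- mu) \<lbrakk>h\<rbrakk> (act app lam \<lbrakk>F\<rbrakk> \<lbrakk>v\<rbrakk>)
    = act app (lam - mu) (act app lam \<lbrakk>G\<rbrakk> \<lbrakk>h\<rbrakk>) \<lbrakk>v\<rbrakk>"
  have P_iff: "?P F \<longleftrightarrow> (\<forall>(h :: 'v cdual) v z n. capp h (- n) (capp F z v) = capp (capp G z h) (z - n) v)" for F
    by (simp add: poly2_eq_iff_ev2 ev2_acts[OF conf_bilinear_app])
  show "?P F"
    by (simp add: P_iff F)
  fix F' assume F': "?P F'"
  have "capp F' z v = capp F z v" for z v
  proof -
    have "capp h n (capp F' z v - capp F z v) = 0" for h :: "'v cdual" and n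
      using F'[unfolded P_iff, rule_format, of h v z "- n"]
      by (simp add: capp_linear F)
    then show ?thesis
      using cdual_separates[OF free] by (metis eq_iff_diff_eq_0)
  qed
  then show "F' = F"
    by (simp add: chom_eq_iff_capp)
qed

section \<open>Derivation, flip, pairing and contraction on tensor products\<close>

lemma dop_tens: "\<partial> (x \<otimes>\<^sub>t y) = \<partial> x \<otimes>\<^sub>t y + x \<otimes>\<^sub>t \<partial> y"
  unfolding dop_tensor_def
  by (rule tlift_tens; rule clinearI)
    (simp_all add: dop_linear tens_add_left tens_add_right tens_scaleC_left tens_scaleC_right
      scaleC_add_right)

lemma tswap_tens: "\<tau> (x \<otimes>\<^sub>t y) = y \<otimes>\<^sub>t x"
  unfolding tswap_def by (intro tlift_tens tens_bilinear)

lemma clinear_tswap: "clinear \<tau>"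
  unfolding tswap_def by (intro clinear_tlift tens_bilinear)

lemma tswap_dop: "\<tau> (\<partial> t) = \<partial> (\<tau> t)"
  by (rule clinear_eq_on_tensor;
      (intro clinear_compose[OF clinear_tswap clinear_dop]
        clinear_compose[OF clinear_dop clinear_tswap])?)
    (simp add: dop_tens tswap_tens clinearD[OF clinear_tswap] add.commute)

lemma tpair_dop: "tpair f \<alpha> g \<beta> (\<partial> t) = (\<alpha> + \<beta>) *\<^sub>C tpair f \<alpha> g \<beta> t"
  by (rule clinear_eq_on_tensor;
      (intro clinear_compose[OF clinear_tpair clinear_dop]
        clinear_compose[OF clinear_scaleC clinear_tpair])?)
    (simp add: dop_tens tpair_linear tpair_tens capp_dop algebra_simps)

lemma tpair_tswap: "tpair f \<alpha> g \<beta> (\<tau> t) = tpair g \<beta> f \<alpha> t"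
  by (rule clinear_eq_on_tensor; (intro clinear_compose[OF clinear_tpair clinear_tswap] clinear_tpair)?)
    (simp add: tswap_tens tpair_tens)

lemma tpair_pev_at: "tpair f \<alpha> g \<beta> (pev_at (dshift z) p) = tpair f \<alpha> g \<beta> (pev p (- z - \<alpha> - \<beta>))"
  by (rule clinear_map_pev_at[OF clinear_tpair]) (simp add: dshift_def tpair_linear tpair_dop algebra_simps)

lemma tpair_tensor_left:
  "tpair f \<alpha> g \<beta> (pev (tensor_left F t) z) = tlift (\<lambda>x y. capp f \<alpha> (capp F z x) * capp g \<beta> y) t"
  by (simp add: tensor_left_def tlift_comp[OF clinear_compose[OF clinear_tpair clinear_pev]]
      pev_map_poly[OF tens_bilinear(2)] tpair_tens)

lemma tpair_tensor_right:
  "tpair f \<alpha> g \<beta> (pev (tensor_right F t) z) = tlift (\<lambda>x y. capp f \<alpha> x * capp g \<beta> (capp F z y)) t"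
  by (simp add: tensor_right_def tlift_comp[OF clinear_compose[OF clinear_tpair clinear_pev]]
      pev_map_poly[OF tens_bilinear(1)] tpair_tens)

text \<open>This is \<open>I \<otimes> f\<close> at \<lambda>, with the scalar moved onto the left
  factor. Contracting the left factor instead means applying it to \<open>\<tau> t\<close>.\<close>

definition contract :: "'b::conf_module cdual \<Rightarrow> 'a::conf_module \<otimes> 'b \<Rightarrow> 'a poly"
  where "contract f = tlift (\<lambda>x y. map_poly (\<lambda>c. c *\<^sub>C x) (app f y))"

lemma clinear_scaleC_left: "clinear (\<lambda>c. c *\<^sub>C x)"
  by (rule clinearI) (simp_all add: scaleC_add_left scaleC_scaleC)

lemma contract_bilinear:
  "clinear (\<lambda>y. map_poly (\<lambda>c. c *\<^sub>C x) (app f y))"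
  "clinear (\<lambda>x. map_poly (\<lambda>c. c *\<^sub>C x) (app f y))"
  by (rule clinearI; rule poly_eq_by_pev;
      simp only: pev_linear pev_map_poly[OF clinear_scaleC_left] capp_linear;
      simp add: scaleC_add_left scaleC_add_right scaleC_scaleC mult.commute)+

lemma clinear_contract: "clinear (contract f)"
  unfolding contract_def by (intro clinear_tlift contract_bilinear)

lemma pev_contract: "pev (contract f t) z = tlift (\<lambda>x y. capp f z y *\<^sub>C x) t"
  by (simp add: contract_def tlift_comp[OF clinear_pev] pev_map_poly[OF clinear_scaleC_left])

lemma contract_tens: "contract f (x \<otimes>\<^sub>t y) = map_poly (\<lambda>c. c *\<^sub>C x) (app f y)"
  unfolding contract_def by (intro tlift_tens contract_bilinear)

text \<open>\<partial> on the surviving factor stays and on the contracted factor becomes \<lambda>.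
  Hence contracting the coproduct gives an element of \<open>cend\<close>.\<close>

lemma contract_dop: "contract f (\<partial> t) = (\<partial> + lam) (contract f t)"
proof (rule clinear_eq_on_tensor)
  show "clinear (\<lambda>t. contract f (\<partial> t))"
    by (rule clinear_compose[OF clinear_contract clinear_dop])
  show "clinear (\<lambda>t. (\<partial> + lam) (contract f t))"
    by (rule clinearI) (simp_all add: clinearD[OF clinear_contract] dop_linear lam_add lam_scaleC
        scaleC_add_right)
  show "contract f (\<partial> (x \<otimes>\<^sub>t y)) = (\<partial> + lam) (contract f (x \<otimes>\<^sub>t y))" for x y
    by (rule poly_eq_by_pev)
      (simp add: dop_tens clinearD[OF clinear_contract] contract_tens pev_linear pev_dop pev_lam
        pev_map_poly[OF clinear_scaleC_left] capp_dop dop_linear scaleC_scaleC)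
qed

text \<open>Evaluating the outer variable is \<open>poly\<close> at a constant polynomial, which
  respects products.\<close>

lemma ev2_mult: "ev2 (P * Q) l m = ev2 P l m * ev2 Q l m" for P Q :: "complex poly poly"
proof -
  have "c *\<^sub>C p = smult c p" for c and p :: "complex poly"
    by (simp add: poly_eq_iff coeff_scaleC)
  then have "pev P l = poly P [:l:]" for P :: "complex poly poly"
    by (simp add: pev_sum poly_altdef poly_const_pow mult.commute)
  then show ?thesis
    by (simp add: ev2_def pev_complex)
qed

section \<open>The matched pair conditions\<close>

lemma tlift_tswap:
  assumes "\<And>x. clinear (f x)" "\<And>y. clinear (\<lambda>x. f x y)"
  shows "tlift f (\<tau> t) = tlift (\<lambda>x y. f y x) t"
  by (rule clinear_eq_on_tensor;
      (intro clinear_compose[OF clinear_tlift clinear_tswap] clinear_tlift assms)?)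
    (simp add: tswap_tens tlift_tens assms)

section \<open>The actions of the algebra and its dual on each other, in evaluated form\<close>

locale conf_coalgebra =
  fixes mA :: "'a::conf_module \<Rightarrow> 'a \<Rightarrow> 'a poly"
    and \<Delta> :: "'a \<Rightarrow> 'a \<otimes> 'a"
    and mD :: "'a cdual \<Rightarrow> 'a cdual \<Rightarrow> 'a cdual poly"
  assumes algebra: "assoc_conf_algebra mA"
    and fin_gen: "\<exists>S::'a set. finite S \<and> module.span pact S = UNIV"
    and free: "\<exists>B::'a set. \<not> module.dependent pact B \<and> module.span pact B = UNIV"
    and hom: "module_hom pact pact \<Delta>"
    and dual_algebra: "assoc_conf_algebra mD"
    and induced: "induced_by mD \<Delta>"
begin

abbreviation "lA \<equiv> \<lambda>a. cdual_map (Rmul mA a)"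
abbreviation "rA \<equiv> \<lambda>a. cdual_map (Lmul mA a)"
abbreviation "lB \<equiv> \<lambda>f. cpredual_map (Rmul mD f)"
abbreviation "rB \<equiv> \<lambda>f. cpredual_map (Lmul mD f)"

lemmas bilA = conf_bilinear_algebra[OF algebra]
lemmas bilD = conf_bilinear_algebra[OF dual_algebra]

lemma clinear_coproduct: "clinear \<Delta>" and coproduct_dop: "\<Delta> (\<partial> a) = \<partial> (\<Delta> a)"
  using hom by (auto simp: module_hom_pact_iff)

lemma capp_Rmul_A: "capp f n (capp (Rmul mA a) z c) = capp f n (pev (mA c a) (- z - n))" for f :: "'a cdual"
  by (simp add: app_Rmul[OF bilA] pev_psubst_cst capp_pev_at)

text \<open>The subscript \<open>- z - (n - z)\<close> coming from right multiplication collapses to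
  \<open>- n\<close>.\<close>

lemma capp_lA: "capp (capp (lA a) z f) n c = capp f (n - z) (pev (mA c a) (- n))"
  by (simp add: capp_cdual_map[OF fin_gen] capp_Rmul_A)

lemma capp_rA: "capp (capp (rA a) z f) n c = capp f (n - z) (pev (mA a c) z)"
  by (simp add: capp_cdual_map[OF fin_gen] app_Lmul[OF bilA])

text \<open>The evaluated form of \<open>induced_by\<close>: products in the dual become pairings
  with the coproduct.\<close>

lemma capp_mD: "capp (pev (mD f g) z) n a = tpair f z g (n - z) (\<Delta> a)"
proof -
  have "ev2 (act app mu (act mD lam \<lbrakk>f\<rbrakk> \<lbrakk>g\<rbrakk>) \<lbrakk>a\<rbrakk>) z n
      = ev2 (tlift (\<lambda>x y. act app lam \<lbrakk>f\<rbrakk> \<lbrakk>x\<rbrakk> * act app (mu - lam) \<lbrakk>g\<rbrakk> \<lbrakk>y\<rbrakk>) (\<Delta> a)) z n"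
    using induced by (simp add: induced_by_def)
  then show ?thesis
    by (simp add: ev2_acts[OF bilD] ev2_acts[OF conf_bilinear_app] tlift_comp[OF clinear_ev2]
        ev2_mult tpair_def)
qed

lemma app_Abs_contract:
  fixes t :: "'a \<Rightarrow> 'a \<otimes> 'a" and f :: "'a cdual"
  assumes "clinear t" "\<And>a. t (\<partial> a) = \<partial> (t a)"
  shows "app (Abs_chom (\<lambda>a. contract f (t a))) = (\<lambda>a. contract f (t a))"
  by (rule Abs_chom_inverse)
    (simp add: clinear_compose[OF clinear_contract assms(1)] assms(2) contract_dop)

lemma capp_contract: "capp h n (pev (contract f t) z) = tpair h n f z t" for h :: "'a cdual"
  by (simp add: pev_contract tlift_comp[OF clinear_capp(1)] capp_linear tpair_def mult.commute)

text \<open>The predual is tested at \<open>z + n\<close>, where the substitution in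
  \<open>Rmul\<close> gives the product of \<open>h\<close> and \<open>f\<close> the subscript
  \<open>(z + n) - z = n\<close>. So \<open>h\<close> meets the left factor at \<open>n\<close>, and
  \<open>f\<close> contracts the right one at \<open>z\<close>.\<close>

lemma app_lB: "app (lB f) a = contract f (\<Delta> a)"
proof -
  let ?F = "Abs_chom (\<lambda>a. contract f (\<Delta> a)) :: 'a cend"
  have F: "app ?F = (\<lambda>a. contract f (\<Delta> a))"
    by (rule app_Abs_contract[OF clinear_coproduct coproduct_dop])
  have "lB f = ?F"
    by (rule cpredual_mapI[OF free])
      (simp add: F capp_contract app_Rmul[OF bilD] pev_psubst_cst capp_pev_at_left capp_mD)
  then show ?thesis by (simp add: F)
qed

text \<open>Here \<open>f\<close> is the left argument of the product and contracts the left factor,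
  whence the flip.\<close>

lemma app_rB: "app (rB f) a = contract f (\<tau> (\<Delta> a))"
proof -
  let ?F = "Abs_chom (\<lambda>a. contract f (\<tau> (\<Delta> a))) :: 'a cend"
  have F: "app ?F = (\<lambda>a. contract f (\<tau> (\<Delta> a)))"
    by (rule app_Abs_contract[OF clinear_compose[OF clinear_tswap clinear_coproduct]])
      (simp add: coproduct_dop tswap_dop)
  have "rB f = ?F"
    by (rule cpredual_mapI[OF free])
      (simp add: F capp_contract app_Lmul[OF bilD] capp_mD tpair_tswap)
  then show ?thesis by (simp add: F)
qed

lemma capp_lB: "capp h n (capp (lB f) z a) = tpair h n f z (\<Delta> a)" for h :: "'a cdual"
  by (simp add: app_lB capp_contract)

lemma capp_rB: "capp h n (capp (rB f) z a) = tpair f z h n (\<Delta> a)" for h :: "'a cdual"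
  by (simp add: app_rB capp_contract tpair_tswap)

text \<open>For actions nested inside a product of the algebra: \<open>\<phi>\<close> will be a dual
  element composed with that product.\<close>

lemma clinear_functional_lB:
  fixes \<phi> :: "'a \<Rightarrow> complex"
  assumes "clinear \<phi>"
  shows "\<phi> (capp (lB f) z a) = tlift (\<lambda>x y. \<phi> x * capp f z y) (\<Delta> a)"
  by (simp add: app_lB pev_contract tlift_comp[OF assms] clinearD[OF assms] mult.commute)

lemma clinear_functional_rB:
  fixes \<phi> :: "'a \<Rightarrow> complex"
  assumes "clinear \<phi>"
  shows "\<phi> (capp (rB f) z a) = tlift (\<lambda>x y. capp f z x * \<phi> y) (\<Delta> a)"
  by (simp add: app_rB pev_contract tlift_comp[OF assms] clinearD[OF assms])
    (intro tlift_tswap clinear_mult clinear_capp assms)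

lemma clinear_capp_mA:
  "clinear (\<lambda>x. capp h n (pev (mA x c) k))"
  "clinear (\<lambda>x. capp h n (pev (mA c x) k))" for h :: "'a cdual"
  by (rule clinear_compose[OF clinear_capp(1) clinear_pev_bilinear(2)[OF bilA]]
      clinear_compose[OF clinear_capp(1) clinear_pev_bilinear(1)[OF bilA]])+

lemmas capp_mA_lB = clinear_functional_lB[OF clinear_capp_mA(1)]
  clinear_functional_lB[OF clinear_capp_mA(2)]
lemmas capp_mA_rB = clinear_functional_rB[OF clinear_capp_mA(1)]
  clinear_functional_rB[OF clinear_capp_mA(2)]

lemma eq_iff_capp: "v = w \<longleftrightarrow> (\<forall>(f :: 'a cdual) n. capp f n v = capp f n w)" for v w :: 'a
proof
  assume "\<forall>(f :: 'a cdual) n. capp f n v = capp f n w"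
  then have "v - w = 0"
    by (intro cdual_separates[OF free]) (simp add: capp_linear)
  then show "v = w" by simp
qed simp

lemma hom_lA: "module_hom pact pact lA"
  unfolding module_hom_pact_iff
  by (intro conjI allI clinearI; (subst chom_eq_iff_capp)+)
    (simp_all add: capp_linear_left capp_lA capp_dop_left clinearD[OF clinear_capp_mA(2)]
      pev_bilinear_dop[OF bilA] capp_linear capp_dop algebra_simps)

lemma hom_rA: "module_hom pact pact rA"
  unfolding module_hom_pact_iff
  by (intro conjI allI clinearI; (subst chom_eq_iff_capp)+)
    (simp_all add: capp_linear_left capp_rA capp_dop_left clinearD[OF clinear_capp_mA(1)]
      pev_bilinear_dop[OF bilA] capp_linear capp_dop algebra_simps)

lemma tpair_linear_left:
  "tpair (f + g) z h n t = tpair f z h n t + tpair g z h n t"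
  "tpair (c *\<^sub>C f) z h n t = c * tpair f z h n t"
  "tpair (\<partial> f) z h n t = - (z * tpair f z h n t)"
  "tpair h n (f + g) z t = tpair h n f z t + tpair h n g z t"
  "tpair h n (c *\<^sub>C f) z t = c * tpair h n f z t"
  "tpair h n (\<partial> f) z t = - (z * tpair h n f z t)"
  for f g :: "'a cdual" and h :: "'a cdual"
  by (induction t rule: tensor_induct)
    (simp_all add: tpair_tens tpair_linear capp_linear_left capp_dop_left algebra_simps)

lemma hom_lB: "module_hom pact pact lB"
  unfolding module_hom_pact_iff
  by (intro conjI allI clinearI; subst chom_eq_iff_capp; subst eq_iff_capp)
    (simp_all add: capp_linear_left capp_linear capp_lB capp_dop_left tpair_linear_left)

lemma hom_rB: "module_hom pact pact rB"
  unfolding module_hom_pact_iff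
  by (intro conjI allI clinearI; subst chom_eq_iff_capp; subst eq_iff_capp)
    (simp_all add: capp_linear_left capp_linear capp_rB capp_dop_left tpair_linear_left)

section \<open>The two bimodule structures\<close>

lemmas ev2_products = ev2_acts[OF bilA] ev2_acts[OF bilD]
  ev2_acts[OF conf_bilinear_module_hom[OF hom_lA]] ev2_acts[OF conf_bilinear_module_hom[OF hom_rA]]
  ev2_acts[OF conf_bilinear_module_hom[OF hom_lB]] ev2_acts[OF conf_bilinear_module_hom[OF hom_rB]]

lemmas pairing = capp_lA capp_rA capp_lB capp_rB capp_linear capp_linear_left
  capp_pev_at capp_pev_at_left capp_bilinear_pev_at[OF bilA]

text \<open>Solved for the outer subscript, so that it rewrites any left-nested product.\<close>

lemma assocA: "pev (mA (pev (mA a b) y) c) z = pev (mA a (pev (mA b c) (z - y))) y"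
  using assoc_pev[OF algebra, of a b y c "z - y"] by simp

lemma assocD: "pev (mD (pev (mD a b) y) c) z = pev (mD a (pev (mD b c) (z - y))) y"
  using assoc_pev[OF dual_algebra, of a b y c "z - y"] by simp

text \<open>Evaluated on an element of the algebra, each axiom compares one dual element on two
  bracketings of a triple product.\<close>

lemma bimodule_dual: "conf_bimodule mA lA rA"
  unfolding conf_bimodule_def
  by (intro conjI hom_lA hom_rA allI; subst poly2_eq_iff_ev2; intro allI; subst chom_eq_iff_capp)
    (simp_all add: ev2_products pairing assocA, simp_all add: diff_diff_eq)

text \<open>Reverses \<open>capp_mD\<close>, folding pairings with the coproduct back into dual
  products so that \<open>assocD\<close> applies.\<close>

lemma tpair_mD: "tpair f z g n (\<Delta> a) = capp (pev (mD f g) z) (n + z) a"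
  by (simp add: capp_mD)

lemma bimodule_algebra: "conf_bimodule mD lB rB"
  unfolding conf_bimodule_def
  by (intro conjI hom_lB hom_rB allI; subst poly2_eq_iff_ev2; intro allI; subst eq_iff_capp)
    (simp_all add: ev2_products pairing tpair_mD assocD,
      simp_all only: diff_conv_add_uminus minus_add_distrib ac_simps simp_thms)

text \<open>The two equations for \<open>\<Delta>\<close> at \<open>\<lambda> = \<kappa>\<close>, paired with \<open>f\<^sub>\<alpha> \<otimes> g\<^sub>\<beta>\<close>.\<close>

definition coprod_mult ::
  "'a \<Rightarrow> 'a \<Rightarrow> complex \<Rightarrow> complex \<Rightarrow> complex \<Rightarrow> 'a cdual \<Rightarrow> 'a cdual \<Rightarrow> bool" where
  "coprod_mult a b \<kappa> \<alpha> \<beta> f g \<longleftrightarrow>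
    tpair f \<alpha> g \<beta> (\<Delta> (pev (mA a b) \<kappa>))
    = tlift (\<lambda>x y. capp f \<alpha> x * capp g \<beta> (pev (mA a y) \<kappa>)) (\<Delta> b)
    + tlift (\<lambda>x y. capp f \<alpha> (pev (mA x b) (\<kappa> + \<beta>)) * capp g \<beta> y) (\<Delta> a)"

definition coprod_balance ::
  "'a \<Rightarrow> 'a \<Rightarrow> complex \<Rightarrow> complex \<Rightarrow> complex \<Rightarrow> 'a cdual \<Rightarrow> 'a cdual \<Rightarrow> bool" where
  "coprod_balance a b \<kappa> \<alpha> \<beta> f g \<longleftrightarrow>
    tlift (\<lambda>x y. capp f \<alpha> (pev (mA b x) (- \<kappa> - \<alpha> - \<beta>)) * capp g \<beta> y) (\<Delta> a)
    - tlift (\<lambda>x y. capp f \<alpha> x * capp g \<beta> (pev (mA y b) (\<kappa> + \<alpha>))) (\<Delta> a)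
    + (tlift (\<lambda>x y. capp g \<beta> (pev (mA a x) \<kappa>) * capp f \<alpha> y) (\<Delta> b)
    - tlift (\<lambda>x y. capp g \<beta> x * capp f \<alpha> (pev (mA y a) (- \<kappa> - \<alpha>))) (\<Delta> b)) = 0"

lemma tensor_eq_iff_tpair: "s = t \<longleftrightarrow> (\<forall>f \<alpha> g \<beta>. tpair f \<alpha> g \<beta> s = tpair f \<alpha> g \<beta> t)"
  for s t :: "'a \<otimes> 'a"
proof
  assume "\<forall>f \<alpha> g \<beta>. tpair f \<alpha> g \<beta> s = tpair f \<alpha> g \<beta> t"
  then have "s - t = 0"
    by (intro tpair_separates[OF free free]) (simp add: tpair_linear)
  then show "s = t" by simp
qed simp

lemmas add_rearrange = add_ac add_diff_eq diff_add_eq diff_diff_eq diff_eq_eq eq_diff_eq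

text \<open>Pairing turns the subscript of \<open>Rmul mA b\<close> into
  \<open>- \<kappa> - \<alpha> - \<beta>\<close>. The product of \<open>x\<close> and
  \<open>b\<close> then carries the negative of this less \<open>\<alpha>\<close>, which is
  \<open>\<kappa> + \<beta>\<close>.\<close>

lemma coprod_mult_iff:
  "map_poly \<Delta> (mA a b) = tensor_right (Lmul mA a) (\<Delta> b)
      + psubst cst (- lam - \<partial>) (tensor_left (Rmul mA b) (\<Delta> a))
    \<longleftrightarrow> (\<forall>\<kappa> f \<alpha> g \<beta>. coprod_mult a b \<kappa> \<alpha> \<beta> f g)"
  by (subst poly_eq_iff_pev, subst tensor_eq_iff_tpair)
    (simp add: pev_map_poly[OF clinear_coproduct] pev_linear pev_psubst_cst tpair_linear
      tpair_pev_at tpair_tensor_left tpair_tensor_right app_Lmul[OF bilA] capp_Rmul_A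
      coprod_mult_def, simp add: add_rearrange)

text \<open>The flip makes \<open>g\<close> meet the left factor of \<open>\<Delta> b\<close> and
  \<open>f\<close> the right one. Right multiplication by \<open>b\<close> ends with subscript
  \<open>\<kappa> + \<alpha>\<close>, that by \<open>a\<close> with
  \<open>- \<kappa> - \<alpha>\<close>.\<close>

lemma coprod_balance_iff:
  "(psubst cst (- lam - \<partial>) (tensor_left (Lmul mA b) (\<Delta> a))
      - psubst cst (- lam - \<partial>) (tensor_right (Rmul mA b) (\<Delta> a)))
      + map_poly \<tau> (tensor_left (Lmul mA a) (\<Delta> b) - tensor_right (Rmul mA a) (\<Delta> b)) = 0
    \<longleftrightarrow> (\<forall>\<kappa> f \<alpha> g \<beta>. coprod_balance a b \<kappa> \<alpha> \<beta> f g)"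
  by (subst poly_eq_iff_pev, subst tensor_eq_iff_tpair)
    (simp add: pev_map_poly[OF clinear_tswap] pev_linear pev_psubst_cst tpair_linear
      tpair_tswap tpair_pev_at tpair_tensor_left tpair_tensor_right app_Lmul[OF bilA] capp_Rmul_A
      coprod_balance_def add_ac diff_diff_eq)

section \<open>The six compatibility conditions\<close>

lemmas evaluate = ev2_products ev2_linear pairing capp_mD capp_mA_lB capp_mA_rB

text \<open>On \<open>c\<close> at \<open>n\<close>, the left side pairs \<open>x\<close> at
  \<open>m\<close> and \<open>y\<close> at \<open>n - l - m\<close> with the coproduct of the
  product of \<open>c\<close> and \<open>a\<close> at \<open>- n\<close>; this dictates the
  parameters.\<close>

lemma matched1_iff:
  "mact lA lam \<lbrakk>a\<rbrakk> (act mD mu \<lbrakk>x\<rbrakk> \<lbrakk>y\<rbrakk>)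
       = act mD (lam + mu) (mact lA lam \<lbrakk>a\<rbrakk> \<lbrakk>x\<rbrakk>) \<lbrakk>y\<rbrakk>
       + mact lA (lam + mu) (mact rB (- lam - \<partial>) \<lbrakk>x\<rbrakk> \<lbrakk>a\<rbrakk>) \<lbrakk>y\<rbrakk>
    \<longleftrightarrow> (\<forall>l m n c. coprod_mult c a (- n) m (n - l - m) x y)"
  by (subst poly2_eq_iff_ev2, subst chom_eq_iff_capp)
    (simp add: evaluate coprod_mult_def tpair_def, simp add: add_rearrange)

text \<open>Under \<open>f\<close> at \<open>n\<close> the subscript of \<open>x\<close> becomes
  \<open>- l - m - n\<close>, and \<open>x\<close> pairs with the left tensor factor.\<close>

lemma matched2_iff:
  "mact rB (- lam - mu - \<partial>) \<lbrakk>x\<rbrakk> (act mA lam \<lbrakk>a\<rbrakk> \<lbrakk>b\<rbrakk>)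
       = act mA lam \<lbrakk>a\<rbrakk> (mact rB (- mu - \<partial>) \<lbrakk>x\<rbrakk> \<lbrakk>b\<rbrakk>)
       + mact rB (- lam - \<partial>) (mact lA mu \<lbrakk>b\<rbrakk> \<lbrakk>x\<rbrakk>) \<lbrakk>a\<rbrakk>
    \<longleftrightarrow> (\<forall>l m f n. coprod_mult a b l (- l - m - n) n x f)"
  by (subst poly2_eq_iff_ev2, subst eq_iff_capp)
    (simp add: evaluate coprod_mult_def tpair_def,
      simp only: diff_conv_add_uminus minus_add_distrib minus_minus add_ac)

lemma matched3_iff:
  "mact lB lam \<lbrakk>x\<rbrakk> (act mA mu \<lbrakk>a\<rbrakk> \<lbrakk>b\<rbrakk>)
       = act mA (lam + mu) (mact lB lam \<lbrakk>x\<rbrakk> \<lbrakk>a\<rbrakk>) \<lbrakk>b\<rbrakk>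
       + mact lB (lam + mu) (mact rA (- lam - \<partial>) \<lbrakk>a\<rbrakk> \<lbrakk>x\<rbrakk>) \<lbrakk>b\<rbrakk>
    \<longleftrightarrow> (\<forall>l m f n. coprod_mult a b m n l f x)"
  by (subst poly2_eq_iff_ev2, subst eq_iff_capp)
    (simp add: evaluate coprod_mult_def tpair_def, simp add: add_rearrange)

text \<open>At \<open>n\<close> the substitution \<open>- \<lambda> - \<mu> - \<partial>\<close>
  becomes \<open>n - l - m\<close>, the subscript in the product of \<open>a\<close> and
  \<open>c\<close>.\<close>

lemma matched4_iff:
  "mact rA (- lam - \<partial>) (mact lB mu \<lbrakk>y\<rbrakk> \<lbrakk>a\<rbrakk>) \<lbrakk>x\<rbrakk>
       + act mD lam \<lbrakk>x\<rbrakk> (mact rA (- mu - \<partial>) \<lbrakk>a\<rbrakk> \<lbrakk>y\<rbrakk>)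
       = mact rA (- lam - mu - \<partial>) \<lbrakk>a\<rbrakk> (act mD lam \<lbrakk>x\<rbrakk> \<lbrakk>y\<rbrakk>)
    \<longleftrightarrow> (\<forall>l m n c. coprod_mult a c (n - l - m) l m x y)"
  by (subst poly2_eq_iff_ev2, subst chom_eq_iff_capp, intro iff_allI)
    (simp add: evaluate coprod_mult_def tpair_def, auto simp: add_rearrange)

text \<open>Each side holds one term with the coproduct of \<open>a\<close> and one with that of the
  test element \<open>c\<close>.\<close>

lemma matched5_iff:
  "mact rA (- lam - \<partial>) (mact rB (- mu - \<partial>) \<lbrakk>y\<rbrakk> \<lbrakk>a\<rbrakk>) \<lbrakk>x\<rbrakk>
       + act mD lam \<lbrakk>x\<rbrakk> (mact lA mu \<lbrakk>a\<rbrakk> \<lbrakk>y\<rbrakk>)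
       = mact lA (lam + mu) (mact lB lam \<lbrakk>x\<rbrakk> \<lbrakk>a\<rbrakk>) \<lbrakk>y\<rbrakk>
       + act mD (lam + mu) (mact rA (- lam - \<partial>) \<lbrakk>a\<rbrakk> \<lbrakk>x\<rbrakk>) \<lbrakk>y\<rbrakk>
    \<longleftrightarrow> (\<forall>l m n c. coprod_balance c a (- n) l (n - l - m) x y)"
  by (subst poly2_eq_iff_ev2, subst chom_eq_iff_capp, intro iff_allI)
    (simp add: evaluate coprod_balance_def tpair_def, auto simp: add_rearrange)

text \<open>The parameters are \<open>l\<close>, \<open>m\<close>, \<open>n\<close> themselves, so
  over all \<open>a\<close>, \<open>b\<close>, \<open>x\<close> this condition is exactly the second
  equation.\<close>

lemma matched6_iff:
  "act mA lam \<lbrakk>a\<rbrakk> (mact lB mu \<lbrakk>x\<rbrakk> \<lbrakk>b\<rbrakk>)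
       + mact rB (- lam - \<partial>) (mact rA (- mu - \<partial>) \<lbrakk>b\<rbrakk> \<lbrakk>x\<rbrakk>) \<lbrakk>a\<rbrakk>
       = act mA (lam + mu) (mact rB (- lam - \<partial>) \<lbrakk>x\<rbrakk> \<lbrakk>a\<rbrakk>) \<lbrakk>b\<rbrakk>
       + mact lB (lam + mu) (mact lA lam \<lbrakk>a\<rbrakk> \<lbrakk>x\<rbrakk>) \<lbrakk>b\<rbrakk>
    \<longleftrightarrow> (\<forall>l m f n. coprod_balance a b l m n x f)"
  by (subst poly2_eq_iff_ev2, subst eq_iff_capp)
    (simp add: evaluate coprod_balance_def tpair_def, simp add: add_rearrange)

text \<open>Once all elements and parameters are quantified, conditions (1) to (4) say the same
  thing, and so do (5) and (6); the bimodule axioms are already established.\<close>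

lemma matched_pair_iff:
  "matched_pair mA mD lA rA lB rB \<longleftrightarrow>
    (\<forall>a b. (\<forall>\<kappa> f \<alpha> g \<beta>. coprod_mult a b \<kappa> \<alpha> \<beta> f g) \<and>
      (\<forall>\<kappa> f \<alpha> g \<beta>. coprod_balance a b \<kappa> \<alpha> \<beta> f g))"
proof -
  have 1: "coprod_mult a b \<kappa> \<alpha> \<beta> f g"
    if "\<forall>a x y l m n c. coprod_mult c a (- n) m (n - l - m) x y" for a b f g \<kappa> \<alpha> \<beta>
    \<comment> \<open>The instance solves \<open>- n = \<kappa>\<close>,
      \<open>m = \<alpha>\<close>, \<open>n - l - m = \<beta>\<close> for \<open>n\<close>,
      \<open>m\<close>, \<open>l\<close>.\<close>
    using that[rule_format, of a b "- \<kappa>" \<alpha> "- \<kappa> - \<alpha> - \<beta>" f g] by simp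
  show ?thesis
    unfolding matched_pair_def matched1_iff matched2_iff matched3_iff matched4_iff matched5_iff
      matched6_iff
    by (auto simp: algebra dual_algebra bimodule_dual bimodule_algebra intro: 1)
qed

end

theorem theorem4p5:
  fixes mA :: "'a::conf_module \<Rightarrow> 'a \<Rightarrow> 'a poly"
    and \<Delta> :: "'a \<Rightarrow> 'a \<otimes> 'a"
    and mD :: "'a cdual \<Rightarrow> 'a cdual \<Rightarrow> 'a cdual poly"
  assumes algebra: "assoc_conf_algebra mA"
    and finitely_generated: "\<exists>S::'a set. finite S \<and> module.span pact S = UNIV"
    and free: "\<exists>B::'a set. \<not> module.dependent pact B \<and> module.span pact B = UNIV"
    and hom: "module_hom pact pact \<Delta>"
    and dual_algebra: "assoc_conf_algebra mD"
    and induced: "induced_by mD \<Delta>"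
  shows "matched_pair mA mD
      (\<lambda>a. cdual_map (Rmul mA a)) (\<lambda>a. cdual_map (Lmul mA a))
      (\<lambda>f. cpredual_map (Rmul mD f)) (\<lambda>f. cpredual_map (Lmul mD f)) \<longleftrightarrow>
    (\<forall>a b.
      map_poly \<Delta> (mA a b)
        = tensor_right (Lmul mA a) (\<Delta> b)
        + psubst cst (- lam - \<partial>) (tensor_left (Rmul mA b) (\<Delta> a)) \<and>
      (psubst cst (- lam - \<partial>) (tensor_left (Lmul mA b) (\<Delta> a))
        - psubst cst (- lam - \<partial>) (tensor_right (Rmul mA b) (\<Delta> a)))
        + map_poly \<tau> (tensor_left (Lmul mA a) (\<Delta> b) - tensor_right (Rmul mA a) (\<Delta> b)) = 0)"
proof -
  interpret conf_coalgebra mA \<Delta> mD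
    by (rule conf_coalgebra.intro) fact+
  show ?thesis
    unfolding matched_pair_iff coprod_mult_iff coprod_balance_iff by (rule refl)
qed

end
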